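(* Let $\boldsymbol\sigma=(\sigma_n)_{n\in\mathbb Z}\in\mathcal S_d^{\mathbb Z}$, with $d\ge2$, be a primitive sequence of substitutions whose sequence of incidence matrices $\mathbf M_{\boldsymbol\sigma}=(M_{\sigma_n})_{n\in\mathbb Z}$ satisfies the local Pisot condition and the growth condition $\lim_{n\to\infty}\frac1n\log\lVert M_{\sigma_n}\rVert=0$. Then the following assertions hold. (i) The sequence $\boldsymbol\sigma$ converges exponentially and, hence, strongly to its generalized right eigenvector $\mathbf u$. (ii) The coordinates of the generalized right eigenvector $\mathbf u$ of $\boldsymbol\sigma$ are rationally independent. (iii) The language $\mathcal L_{\boldsymbol\sigma}$ is balanced.
   Context: $\mathcal A=\{1,\dots,d\}$, $\mathcal A^*$ is the free monoid of finite words over $\mathcal A$. A substitution is an endomorphism $\sigma$ of $\mathcal A^*$ mapping letters to nonempty words; $|w|$ is the length of $w$, $|w|_a$ the number of occurrences of $a$ in $w$; the incidence matrix is $M_\sigma=(|\sigma(b)|_a)_{a,b\in\mathcal A}$; $\mathcal S_d$ is the set of substitutions over $\mathcal A$ with $|\det M_\sigma|=1$. $\sigma_{[m,n)}=\sigma_m\circ\cdots\circ\sigma_{n-1}$, so $M_{\sigma_{[m,n)}}=M_{\sigma_m}\cdots M_{\sigma_{n-1}}$. Primitive: for each $m\in\mathbb Z$ there is $n>m$ such that all entries of $M_{\sigma_{[m,n)}}$ are positive. Local Pisot condition: $\limsup_{n\to\infty}\frac1n\log\delta_2(M_{\sigma_{[0,n)}})<0$, $\delta_2$ being the second largest singular value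 (with multiplicity). $\lVert\cdot\rVert$ is any matrix norm. Generalized right eigenvector: $\mathbf u\in\mathbb R_{\ge0}^d\setminus\{\mathbf 0\}$ with $\bigcap_{n\ge0}M_{\sigma_{[0,n)}}\mathbb R_{\ge0}^d=\mathbb R_{\ge0}\mathbf u$. $\boldsymbol\sigma$ converges exponentially to $\mathbf u$ if there are $C,\alpha>0$ with $\mathrm d(M_{\sigma_{[0,n)}}\mathbf e_i,\mathbb R\mathbf u)\le Ce^{-\alpha n}$ for all $n\in\mathbb N$ and all standard basis vectors $\mathbf e_i$; strongly if $\mathrm d(M_{\sigma_{[0,n)}}\mathbf e_i,\mathbb R\mathbf u)\to0$ for all $i$ ($\mathrm d$ is Euclidean distance). $\mathcal L_{\boldsymbol\sigma}$ is the set of words $w\in\mathcal A^*$ that are factors of $\sigma_{[0,m)}(a)$ for some $a\in\mathcal A$, $m>0$. It is balanced if there is $C\in\mathbb N$ such that $|v|_a-|w|_a\le C$ for all $v,w\in\mathcal L_{\boldsymbol\sigma}$ with $|v|=|w|$ and all $a\in\mathcal A$. *)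

theory Defs
  imports "HOL-Analysis.Analysis" "HOL-Library.Multiset" "HOL-Library.Sublist"
begin

text \<open>
  The alphabet is a finite type \<open>'a\<close>, so \<open>d = CARD('a)\<close>, and finite words are lists over \<open>'a\<close>.
\<close>

definition substitution :: "('a list \<Rightarrow> 'a list) \<Rightarrow> bool" where
  "substitution s \<longleftrightarrow>
     s [] = [] \<and> (\<forall>v w. s (v @ w) = s v @ s w) \<and> (\<forall>a. s [a] \<noteq> [])"

definition incidence_matrix :: "('a list \<Rightarrow> 'a list) \<Rightarrow> real ^ 'a ^ 'a" where
  "incidence_matrix s = (\<chi> a b. real (count_list (s [b]) a))"

definition unimodular_substitutions :: "('a::finite list \<Rightarrow> 'a list) set" where
  "unimodular_substitutions = {s. substitution s \<and> \<bar>det (incidence_matrix s)\<bar> = 1}"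

text \<open>
  \<open>block \<sigma> m n\<close> is \<open>\<sigma>\<^sub>m \<circ> \<dots> \<circ> \<sigma>\<^sub>n\<^sub>-\<^sub>1\<close>; it is the identity if \<open>n \<le> m\<close>.
\<close>

definition block :: "(int \<Rightarrow> 'a list \<Rightarrow> 'a list) \<Rightarrow> int \<Rightarrow> int \<Rightarrow> 'a list \<Rightarrow> 'a list" where
  "block \<sigma> m n = foldr (\<circ>) (map \<sigma> [m..n - 1]) id"

definition primitive :: "(int \<Rightarrow> 'a::finite list \<Rightarrow> 'a list) \<Rightarrow> bool" where
  "primitive \<sigma> \<longleftrightarrow>
     (\<forall>m. \<exists>n>m. \<forall>a b. 0 < incidence_matrix (block \<sigma> m n) $ a $ b)"

text \<open>
  The singular values of \<open>A\<close> are the numbers \<open>s \<ge> 0\<close> such that \<open>s\<^sup>2\<close> is an eigenvalue of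
  \<open>A\<^sup>T A\<close>. They are counted with the dimension of the eigenspace, which for the symmetric matrix
  \<open>A\<^sup>T A\<close> agrees with the algebraic multiplicity. The sum below ranges over a finite set, and the
  resulting multiset has exactly \<open>CARD('n)\<close> elements.
\<close>

definition gram_eigenspace :: "real ^ 'n ^ 'n \<Rightarrow> real \<Rightarrow> (real ^ 'n) set" where
  "gram_eigenspace A s = {x. (transpose A ** A) *v x = s\<^sup>2 *\<^sub>R x}"

definition singular_values :: "real ^ 'n ^ 'n \<Rightarrow> real multiset" where
  "singular_values A =
     (\<Sum>s | 0 \<le> s \<and> gram_eigenspace A s \<noteq> {0}. replicate_mset (dim (gram_eigenspace A s)) s)"

text \<open>The \<open>k\<close>-th largest singular value, for \<open>1 \<le> k \<le> CARD('n)\<close>.\<close>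

definition singular_value :: "nat \<Rightarrow> real ^ 'n ^ 'n \<Rightarrow> real" where
  "singular_value k A = rev (sorted_list_of_multiset (singular_values A)) ! (k - 1)"

text \<open>The limit superior is taken in the extended reals, since it may be \<open>-\<infinity>\<close>.\<close>

definition local_Pisot :: "(int \<Rightarrow> 'a::finite list \<Rightarrow> 'a list) \<Rightarrow> bool" where
  "local_Pisot \<sigma> \<longleftrightarrow>
     limsup (\<lambda>n. ereal (ln (singular_value 2 (incidence_matrix (block \<sigma> 0 (int n)))) / real n)) < 0"

definition is_norm :: "('v::real_vector \<Rightarrow> real) \<Rightarrow> bool" where
  "is_norm N \<longleftrightarrow>
     (\<forall>x. 0 \<le> N x) \<and> (\<forall>x. N x = 0 \<longleftrightarrow> x = 0) \<and>
     (\<forall>c x. N (c *\<^sub>R x) = \<bar>c\<bar> * N x) \<and> (\<forall>x y. N (x + y) \<le> N x + N y)"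

definition growth_condition ::
    "(real ^ 'a ^ 'a \<Rightarrow> real) \<Rightarrow> (int \<Rightarrow> 'a::finite list \<Rightarrow> 'a list) \<Rightarrow> bool" where
  "growth_condition N \<sigma> \<longleftrightarrow>
     (\<lambda>n. ln (N (incidence_matrix (\<sigma> (int n)))) / real n) \<longlonglongrightarrow> 0"

definition nonneg_orthant :: "(real ^ 'a) set" where
  "nonneg_orthant = {x. \<forall>a. 0 \<le> x $ a}"

definition generalized_right_eigenvector ::
    "(int \<Rightarrow> 'a::finite list \<Rightarrow> 'a list) \<Rightarrow> real ^ 'a \<Rightarrow> bool" where
  "generalized_right_eigenvector \<sigma> u \<longleftrightarrow>
     u \<in> nonneg_orthant - {0} \<and>
     (\<Inter>n::nat. (*v) (incidence_matrix (block \<sigma> 0 (int n))) ` nonneg_orthant)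
       = {t *\<^sub>R u | t. 0 \<le> t}"

definition converges_exponentially ::
    "(int \<Rightarrow> 'a::finite list \<Rightarrow> 'a list) \<Rightarrow> real ^ 'a \<Rightarrow> bool" where
  "converges_exponentially \<sigma> u \<longleftrightarrow>
     (\<exists>C>0. \<exists>\<alpha>>0. \<forall>(n::nat) i.
        infdist (incidence_matrix (block \<sigma> 0 (int n)) *v axis i 1) (range (\<lambda>t. t *\<^sub>R u))
          \<le> C * exp (- \<alpha> * real n))"

definition converges_strongly ::
    "(int \<Rightarrow> 'a::finite list \<Rightarrow> 'a list) \<Rightarrow> real ^ 'a \<Rightarrow> bool" where
  "converges_strongly \<sigma> u \<longleftrightarrow>
     (\<forall>i. (\<lambda>n::nat. infdist (incidence_matrix (block \<sigma> 0 (int n)) *v axis i 1)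
                 (range (\<lambda>t. t *\<^sub>R u))) \<longlonglongrightarrow> 0)"

definition rationally_independent :: "real ^ 'a \<Rightarrow> bool" where
  "rationally_independent u \<longleftrightarrow>
     (\<forall>q :: 'a \<Rightarrow> rat. (\<Sum>a\<in>UNIV. of_rat (q a) * u $ a) = 0 \<longrightarrow> (\<forall>a. q a = 0))"

definition language :: "(int \<Rightarrow> 'a list \<Rightarrow> 'a list) \<Rightarrow> 'a list set" where
  "language \<sigma> = {w. \<exists>a. \<exists>m>0. sublist w (block \<sigma> 0 m [a])}"

definition balanced :: "'a list set \<Rightarrow> bool" where
  "balanced L \<longleftrightarrow>
     (\<exists>C::nat. \<forall>v\<in>L. \<forall>w\<in>L. length v = length w \<longrightarrow>
        (\<forall>a. int (count_list v a) - int (count_list w a) \<le> int C))"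

end

theory Submission
  imports Defs
begin

text \<open>
  Write \<open>M\<^sub>n\<close> and \<open>A\<^sub>n\<close> for the incidence matrices of \<open>\<sigma>\<^sub>n\<close> and \<open>\<sigma>\<^sub>0 \<circ> \<dots> \<circ> \<sigma>\<^sub>n\<^sub>-\<^sub>1\<close>, and \<open>T\<^sub>n\<close> for the sum of the
  entries of \<open>A\<^sub>n\<close>, which is nondecreasing in \<open>n\<close>.
  Up to an error of the size of the second singular value, \<open>A\<^sub>n\<close> has rank one, so any two nonnegative
  vectors have nearly proportional images under \<open>A\<^sub>n\<close>. Comparing \<open>A\<^sub>n 1\<close> with \<open>A\<^sub>n (M\<^sub>n 1) = A\<^sub>n\<^sub>+\<^sub>1 1\<close>,
  one sees that the direction of \<open>A\<^sub>n 1\<close> moves by at most \<open>C r\<^sup>n / T\<^sub>n\<close> with \<open>r < 1\<close>, the subexponential growth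
  of \<open>M\<^sub>n\<close> being absorbed in \<open>r\<close>. The directions therefore converge to some \<open>u\<close>, and the factor
  \<open>1 / T\<^sub>n\<close> cancels the length of the columns of \<open>A\<^sub>n\<close>, which thus approach the line through \<open>u\<close>
  exponentially fast. A rational relation between the coordinates of \<open>u\<close> then yields a nonzero integer
  functional vanishing on all columns of some \<open>A\<^sub>n\<close>, contradicting \<open>det A\<^sub>n \<noteq> 0\<close>; and the
  Dumont--Thomas decomposition of prefixes bounds the distance of the abelianization of every factor from the
  line through \<open>u\<close> by a convergent series.
\<close>

subsection \<open>The second singular value\<close>

lemma inner_gram:
  fixes A :: "real ^ 'n ^ 'n"
  shows "((transpose A ** A) *v x) \<bullet> y = (A *v x) \<bullet> (A *v y)"
  by (metis dot_lmul_matrix inner_commute matrix_vector_mul_assoc transpose_matrix_vector)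

text \<open>A maximiser \<open>x\<close> of \<open>norm (A *v y)\<close> on the unit sphere of
  \<open>V\<close> is an eigenvector: the first-order condition makes
  \<open>s\<^sup>2 *\<^sub>R x - (transpose A ** A) *v x\<close> orthogonal to \<open>V\<close>, and
  by invariance this vector lies in \<open>V\<close> itself.\<close>

lemma ex_unit_eigenvector_of_gram:
  fixes A :: "real ^ 'n ^ 'n"
  assumes V: "subspace V" and inv: "\<And>x. x \<in> V \<Longrightarrow> (transpose A ** A) *v x \<in> V"
    and nz: "z \<in> V" "z \<noteq> 0"
  obtains x s where "x \<in> V" "norm x = 1" "0 \<le> s" "x \<in> gram_eigenspace A s"
    "\<And>y. y \<in> V \<Longrightarrow> norm (A *v y) \<le> s * norm y"
proof -
  let ?S = "sphere 0 1 \<inter> V"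
  have "compact ?S"
    by (intro compact_Int_closed compact_sphere closed_subspace V)
  moreover have "(1 / norm z) *\<^sub>R z \<in> ?S"
    using nz V by (auto simp: subspace_scale)
  then have "?S \<noteq> {}" by blast
  moreover have "continuous_on ?S (\<lambda>y. norm (A *v y))"
    by (intro continuous_intros)
  ultimately obtain x where x: "x \<in> ?S" and max: "\<forall>y\<in>?S. norm (A *v y) \<le> norm (A *v x)"
    using continuous_attains_sup by blast
  define s where "s = norm (A *v x)"
  have xV: "x \<in> V" and nx: "norm x = 1" using x by auto
  have bound: "norm (A *v y) \<le> s * norm y" if "y \<in> V" for y
  proof (cases "y = 0")
    case False
    then have "(1 / norm y) *\<^sub>R y \<in> ?S" using that V by (auto simp: subspace_scale)
    then have "norm (A *v ((1 / norm y) *\<^sub>R y)) \<le> s" using max s_def by blast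
    then show ?thesis using False by (simp add: matrix_vector_mult_scaleR field_simps)
  qed auto
  \<comment> \<open>The quadratic form
    \<open>s\<^sup>2 * (norm y)\<^sup>2 - (norm (A *v y))\<^sup>2\<close> is nonnegative on
    \<open>V\<close> and vanishes at \<open>x\<close>, so its derivative at \<open>x\<close> in each
    direction \<open>z\<close> of \<open>V\<close> is zero.\<close>
  have orth: "s\<^sup>2 * (x \<bullet> z) - (A *v x) \<bullet> (A *v z) = 0" (is "?B = 0") if z: "z \<in> V" for z
  proof -
    define Q where "Q = s\<^sup>2 * (norm z)\<^sup>2 - (norm (A *v z))\<^sup>2"
    have "0 \<le> 2 * t * ?B + t\<^sup>2 * Q" for t
    proof -
      have "x + t *\<^sub>R z \<in> V" using xV z V by (simp add: subspace_add subspace_scale)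
      then have "(norm (A *v (x + t *\<^sub>R z)))\<^sup>2 \<le> (s * norm (x + t *\<^sub>R z))\<^sup>2"
        using bound by (intro power_mono) auto
      moreover have "(norm (A *v (x + t *\<^sub>R z)))\<^sup>2
          = s\<^sup>2 + 2 * t * ((A *v x) \<bullet> (A *v z)) + t\<^sup>2 * (norm (A *v z))\<^sup>2"
        unfolding s_def power2_norm_eq_inner
        by (simp add: matrix_vector_right_distrib matrix_vector_mult_scaleR inner_simps
            inner_commute algebra_simps power2_eq_square)
      moreover have "(norm (x + t *\<^sub>R z))\<^sup>2 = 1 + 2 * t * (x \<bullet> z) + t\<^sup>2 * (norm z)\<^sup>2"
        using nx unfolding norm_eq_1 power2_norm_eq_inner
        by (simp add: inner_simps inner_commute algebra_simps power2_eq_square)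
      ultimately show ?thesis by (simp add: Q_def power_mult_distrib algebra_simps)
    qed
    note q = this
    show ?thesis
    proof (rule ccontr)
      assume nB: "?B \<noteq> 0"
      \<comment> \<open>Positive and larger than \<open>Q\<close> whatever the sign of
        \<open>Q\<close>, so that the quadratic in \<open>t\<close> becomes negative at
        \<open>t = - ?B / r\<close>.\<close>
      define r where "r = \<bar>Q\<bar> + 1"
      have r: "r > 0" "Q < r" by (auto simp: r_def)
      have "0 \<le> 2 * (- ?B / r) * ?B + (- ?B / r)\<^sup>2 * Q" by (rule q)
      also have "\<dots> \<le> 2 * (- ?B / r) * ?B + (- ?B / r)\<^sup>2 * r"
        using r by (intro add_left_mono mult_left_mono) auto
      also have "\<dots> = - (?B\<^sup>2 / r)" using r by (simp add: field_simps power2_eq_square)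
      also have "\<dots> < 0" using nB r by simp
      finally show False by simp
    qed
  qed
  define e where "e = s\<^sup>2 *\<^sub>R x - (transpose A ** A) *v x"
  have "e \<in> V" unfolding e_def using xV V inv by (simp add: subspace_diff subspace_scale)
  then have "e \<bullet> e = 0"
    using orth[of e] by (subst (1) e_def) (simp add: inner_simps inner_gram)
  then have "x \<in> gram_eigenspace A s" by (simp add: gram_eigenspace_def e_def)
  then show thesis using that xV nx bound s_def by (metis norm_ge_zero)
qed

lemma gram_eigenspaces_orthogonal:
  assumes "x \<in> gram_eigenspace A s" "y \<in> gram_eigenspace A t" "s\<^sup>2 \<noteq> t\<^sup>2"
  shows "orthogonal x y"
proof -
  have "s\<^sup>2 * (x \<bullet> y) = (A *v x) \<bullet> (A *v y)" "t\<^sup>2 * (x \<bullet> y) = (A *v x) \<bullet> (A *v y)"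
    using assms(1,2) inner_gram[of A x y] inner_gram[of A y x]
    by (auto simp: gram_eigenspace_def inner_commute)
  then show ?thesis using assms(3) by (simp add: orthogonal_def) (metis mult_right_cancel)
qed

text \<open>Eigenvectors for distinct values are orthogonal, and an orthogonal family in finite
  dimension is finite. This keeps the sum in \<open>singular_values\<close> from being the default
  value of a sum over an infinite set.\<close>

lemma finite_singular_values:
  "finite {s. 0 \<le> s \<and> gram_eigenspace A s \<noteq> {0}}" (is "finite ?S")
proof -
  have "\<exists>x. x \<in> gram_eigenspace A s \<and> x \<noteq> 0" if "s \<in> ?S" for s
  proof -
    have "0 \<in> gram_eigenspace A s" by (simp add: gram_eigenspace_def)
    with that show ?thesis by auto
  qed
  then obtain x where x: "\<And>s. s \<in> ?S \<Longrightarrow> x s \<in> gram_eigenspace A s \<and> x s \<noteq> 0"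
    by metis
  have orth: "orthogonal (x s) (x t)" if "s \<in> ?S" "t \<in> ?S" "s \<noteq> t" for s t
    using that gram_eigenspaces_orthogonal[of "x s" A s "x t" t] x by force
  have "inj_on x ?S"
  proof (rule inj_onI)
    fix s t assume st: "s \<in> ?S" "t \<in> ?S" "x s = x t"
    then have "s \<noteq> t \<Longrightarrow> orthogonal (x s) (x s)" using orth[of s t] by simp
    then show "s = t" using st(1) x[of s] by (auto simp: orthogonal_self)
  qed
  moreover have "pairwise orthogonal (x ` ?S)"
    using orth by (auto simp: pairwise_def)
  then have "finite (x ` ?S)"
    by (rule pairwise_orthogonal_imp_finite)
  ultimately show ?thesis using finite_image_iff by blast
qed

lemma count_singular_values:
  assumes "0 \<le> s"
  shows "count (singular_values A) s = dim (gram_eigenspace A s)"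
proof -
  let ?S = "{t. 0 \<le> t \<and> gram_eigenspace A t \<noteq> {0}}"
  have "count (singular_values A) s
      = (\<Sum>t\<in>?S. count (replicate_mset (dim (gram_eigenspace A t)) t) s)"
    unfolding singular_values_def by (rule count_sum)
  also have "\<dots> = (\<Sum>t\<in>?S. if t = s then dim (gram_eigenspace A t) else 0)"
    by (intro sum.cong refl) (simp add: count_replicate_mset)
  also have "\<dots> = (if s \<in> ?S then dim (gram_eigenspace A s) else 0)"
    using finite_singular_values[of A] by (rule sum.delta)
  also have "\<dots> = dim (gram_eigenspace A s)"
    using assms by (cases "gram_eigenspace A s = {0}") simp_all
  finally show ?thesis .
qed

text \<open>Index 1 is the second entry of the decreasing list. Were it smaller than
  \<open>b\<close>, only the first entry could be at least \<open>b\<close>, while \<open>a\<close>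
  and \<open>b\<close> count as two such elements.\<close>

lemma second_largest_ge:
  fixes X :: "real multiset"
  assumes "{#a, b#} \<subseteq># X" "b \<le> a"
  shows "b \<le> rev (sorted_list_of_multiset X) ! 1"
proof -
  define xs where "xs = rev (sorted_list_of_multiset X)"
  have ms: "mset xs = X" and so: "sorted_wrt (\<ge>) xs"
    by (simp_all add: xs_def sorted_wrt_rev)
  have "size {#a, b#} \<le> size X" using assms(1) size_mset_mono by blast
  then have "2 \<le> length xs"
    by (simp flip: ms)
  then obtain x y zs where xs: "xs = x # y # zs"
    by (metis Suc_le_length_iff numeral_2_eq_2)
  have "b \<le> y"
  proof (rule ccontr)
    assume "\<not> b \<le> y"
    then have "filter (\<lambda>z. b \<le> z) (y # zs) = []"
      using so xs by (auto simp: filter_empty_conv)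
    then have "size (filter_mset (\<lambda>z. b \<le> z) X) \<le> 1"
      unfolding ms[symmetric] xs mset_filter[symmetric] size_mset filter.simps(2)[of _ x] by simp
    moreover have "filter_mset (\<lambda>z. b \<le> z) {#a, b#} \<subseteq># filter_mset (\<lambda>z. b \<le> z) X"
      using assms(1) by (rule multiset_filter_mono)
    then have "2 \<le> size (filter_mset (\<lambda>z. b \<le> z) X)"
      using assms(2) by (auto dest: size_mset_mono)
    ultimately show False by simp
  qed
  then show ?thesis using xs xs_def by simp
qed

text \<open>One half of the Courant--Fischer principle, with \<open>v\<close> a top right singular
  vector: the Gram matrix preserves the hyperplane orthogonal to \<open>v\<close>, so the best
  constant \<open>t\<close> on it is again a singular value and at most the second largest.\<close>

lemma second_singular_value_bound:
  fixes A :: "real ^ 'n ^ 'n"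
  assumes d: "2 \<le> CARD('n)"
  obtains v where "norm v = 1"
    "\<And>x. x \<bullet> v = 0 \<Longrightarrow> norm (A *v x) \<le> singular_value 2 A * norm x"
proof -
  obtain v s where v: "norm v = 1" "0 \<le> s" "v \<in> gram_eigenspace A s"
    and s: "\<And>y. norm (A *v y) \<le> s * norm y"
    by (rule ex_unit_eigenvector_of_gram[of UNIV A "axis undefined 1"]) (auto simp: axis_eq_0_iff)
  \<comment> \<open>Dimension at least 2 makes the hyperplane orthogonal to \<open>v\<close>
    nonzero, as the search for a second eigenvector requires.\<close>
  have "2 \<le> DIM(real ^ 'n)" using d by simp
  then obtain z where z: "z \<noteq> 0" "orthogonal v z"
    using orthogonal_to_vector_exists[of v] by blast
  have inv: "((transpose A ** A) *v x) \<bullet> v = 0" if "x \<bullet> v = 0" for x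
  proof -
    have "((transpose A ** A) *v x) \<bullet> v = x \<bullet> ((transpose A ** A) *v v)"
      by (metis inner_gram inner_commute)
    then show ?thesis using that v by (simp add: gram_eigenspace_def)
  qed
  have sub: "subspace {x. x \<bullet> v = 0}" by (simp add: subspace_hyperplane2)
  obtain w t where w: "w \<bullet> v = 0" "norm w = 1" "0 \<le> t" "w \<in> gram_eigenspace A t"
    and t: "\<And>y. y \<bullet> v = 0 \<Longrightarrow> norm (A *v y) \<le> t * norm y"
    by (rule ex_unit_eigenvector_of_gram[of "{x. x \<bullet> v = 0}" A z])
       (use sub inv z in \<open>auto simp: orthogonal_def inner_commute\<close>)
  have eig: "(A *v w) \<bullet> (A *v w) = t\<^sup>2"
    using w inner_gram[of A w w] by (simp add: gram_eigenspace_def norm_eq_1)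
  have "t \<le> s"
    using s[of w] w eig by (metis norm_eq_sqrt_inner mult.right_neutral real_sqrt_unique)
  have pos: "1 \<le> dim (gram_eigenspace A r)" if "x \<in> gram_eigenspace A r" "norm x = 1" for x r
  proof -
    have "dim {x} \<le> dim (gram_eigenspace A r)" using that by (intro dim_subset) auto
    moreover have "dim {x} = 1" using that by (auto simp: dim_singleton)
    ultimately show ?thesis by simp
  qed
  \<comment> \<open>Multiplicity matters if \<open>s = t\<close>: then the orthogonal vectors
    \<open>v\<close> and \<open>w\<close> make the eigenspace at least two-dimensional.\<close>
  have "{#s, t#} \<subseteq># singular_values A"
  proof (cases "s = t")
    case True
    have "v \<noteq> w" using v w by auto
    have "pairwise orthogonal {v, w}" "0 \<notin> {v, w}"
      using v w by (auto simp: pairwise_def orthogonal_def inner_commute)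
    then have "independent {v, w}" by (rule pairwise_orthogonal_independent)
    then have "card {v, w} \<le> dim (gram_eigenspace A s)"
      using v w True by (intro independent_card_le_dim) auto
    then have "2 \<le> dim (gram_eigenspace A s)" using \<open>v \<noteq> w\<close> by simp
    then show ?thesis using True v count_singular_values[of s A]
      by (auto simp: subseteq_mset_def)
  next
    case False
    then show ?thesis
      using v w pos[of v s] pos[of w t] count_singular_values[of s A] count_singular_values[of t A]
      by (auto simp: subseteq_mset_def simp flip: count_greater_zero_iff)
  qed
  then have "t \<le> singular_value 2 A"
    using second_largest_ge[OF _ \<open>t \<le> s\<close>] by (simp add: singular_value_def)
  then show thesis
    using that[of v] v t by (meson mult_right_mono norm_ge_zero order_trans)
qed

subsection \<open>Exponential alignment of matrix products\<close>

text \<open>On the nonnegative orthant this is the l1 norm; being linear, it is a convenient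
  normalisation of directions.\<close>

definition coord_sum :: "real ^ 'n \<Rightarrow> real" where
  "coord_sum x = (\<Sum>i\<in>UNIV. x $ i)"

lemma linear_coord_sum: "linear (coord_sum :: real ^ 'n \<Rightarrow> real)"
  by (rule linearI) (simp_all add: coord_sum_def sum.distrib sum_distrib_left)

lemmas coord_sum_simps =
  linear_add[OF linear_coord_sum] linear_diff[OF linear_coord_sum]
  linear_scale[OF linear_coord_sum] linear_0[OF linear_coord_sum]

lemma abs_coord_sum_le: "\<bar>coord_sum (x :: real ^ 'n)\<bar> \<le> CARD('n) * norm x"
proof -
  have "\<bar>coord_sum x\<bar> \<le> (\<Sum>i\<in>UNIV. \<bar>x $ i\<bar>)" unfolding coord_sum_def by (rule sum_abs)
  also have "\<dots> \<le> (\<Sum>i\<in>(UNIV::'n set). norm x)" by (intro sum_mono component_le_norm_cart)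
  finally show ?thesis by simp
qed

lemma tendsto_coord_sum:
  assumes "(f \<longlongrightarrow> x) F" shows "((\<lambda>n. coord_sum (f n)) \<longlongrightarrow> coord_sum x) F"
  unfolding coord_sum_def by (intro tendsto_intros assms)

lemma norm_le_coord_sum:
  assumes "x \<in> nonneg_orthant" shows "norm x \<le> coord_sum x"
proof -
  have "norm x \<le> (\<Sum>i\<in>UNIV. \<bar>x $ i\<bar>)" by (rule norm_le_l1_cart)
  then show ?thesis using assms by (simp add: nonneg_orthant_def coord_sum_def)
qed

lemma coord_sum_nonneg: "x \<in> nonneg_orthant \<Longrightarrow> 0 \<le> coord_sum x"
  by (auto simp: nonneg_orthant_def coord_sum_def intro: sum_nonneg)

lemma closed_nonneg_orthant: "closed (nonneg_orthant :: (real ^ 'n) set)"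
  unfolding nonneg_orthant_def by (intro closed_Collect_all closed_Collect_le continuous_intros)

lemma nonneg_orthant_simps:
  "1 \<in> nonneg_orthant" "axis i 1 \<in> nonneg_orthant" "1 - axis i 1 \<in> nonneg_orthant"
  by (auto simp: nonneg_orthant_def axis_def)

lemma nonneg_orthant_scaleR: "x \<in> nonneg_orthant \<Longrightarrow> 0 \<le> c \<Longrightarrow> c *\<^sub>R x \<in> nonneg_orthant"
  by (auto simp: nonneg_orthant_def)

lemma coord_sum_axis: "coord_sum (axis i 1 :: real ^ 'n) = 1"
  by (simp add: coord_sum_def axis_def)

text \<open>Modulo the part contracted by \<open>\<delta>\<close>, both images lie on the line through \<open>A *v v\<close>, and the
  rank-one parts cancel in the difference.\<close>

lemma nearly_parallel_images:
  fixes A :: "real ^ 'n ^ 'n"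
  assumes v: "norm v = 1" and contr: "\<And>x. x \<bullet> v = 0 \<Longrightarrow> norm (A *v x) \<le> \<delta> * norm x"
    and \<delta>: "0 \<le> \<delta>" "\<delta> \<le> D"
    and x: "norm (A *v x) \<le> coord_sum (A *v x)" "norm x \<le> coord_sum (A *v x)"
    and y: "norm (A *v y) \<le> coord_sum (A *v y)" "norm y \<le> coord_sum (A *v y)"
  shows "norm (coord_sum (A *v x) *\<^sub>R (A *v y) - coord_sum (A *v y) *\<^sub>R (A *v x))
    \<le> (1 + (1 + 2 * D) * CARD('n)) * \<delta>
        * (norm x * coord_sum (A *v y) + norm y * coord_sum (A *v x))"
proof -
  define p where "p = A *v v"
  define e where "e z = A *v (z - (z \<bullet> v) *\<^sub>R v)" for z
  have dec: "A *v z = (z \<bullet> v) *\<^sub>R p + e z" for z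
    by (simp add: e_def p_def matrix_vector_mult_diff_distrib matrix_vector_mult_scaleR)
  have e: "norm (e z) \<le> \<delta> * norm z" for z
  proof -
    have vv: "v \<bullet> v = 1" using v by (simp add: norm_eq_1)
    have o: "(z - (z \<bullet> v) *\<^sub>R v) \<bullet> v = 0" by (simp add: inner_diff_left vv)
    have "(norm (z - (z \<bullet> v) *\<^sub>R v))\<^sup>2 = z \<bullet> z - (z \<bullet> v)\<^sup>2"
      unfolding power2_norm_eq_inner
      by (simp add: inner_diff_left inner_diff_right vv inner_commute power2_eq_square)
    also have "\<dots> \<le> (norm z)\<^sup>2" by (simp add: power2_norm_eq_inner)
    finally have "norm (z - (z \<bullet> v) *\<^sub>R v) \<le> norm z" by (rule power2_le_imp_le) simp
    then have "\<delta> * norm (z - (z \<bullet> v) *\<^sub>R v) \<le> \<delta> * norm z"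
      using \<delta>(1) by (rule mult_left_mono)
    with contr[OF o] show ?thesis unfolding e_def by (rule order_trans)
  qed
  define d where "d = real CARD('n)"
  define X where "X = coord_sum (A *v x)"
  define Y where "Y = coord_sum (A *v y)"
  define f where "f = coord_sum (e x)"
  define g where "g = coord_sum (e y)"
  have pos: "0 \<le> X" "0 \<le> Y" "0 \<le> d" "0 \<le> D"
    using order_trans[OF norm_ge_zero x(1)] order_trans[OF norm_ge_zero y(1)] \<delta>
    by (simp_all add: X_def Y_def d_def)
  have fg: "\<bar>f\<bar> \<le> d * (\<delta> * norm x)" "\<bar>g\<bar> \<le> d * (\<delta> * norm y)"
    unfolding f_def g_def d_def
    by (rule order_trans[OF abs_coord_sum_le mult_left_mono[OF e]], simp)+
  have XY: "X = (x \<bullet> v) * coord_sum p + f" "Y = (y \<bullet> v) * coord_sum p + g"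
    unfolding X_def Y_def f_def g_def by (subst dec, simp add: coord_sum_simps)+
  have Ax: "A *v x = (x \<bullet> v) *\<^sub>R p + e x" and Ay: "A *v y = (y \<bullet> v) *\<^sub>R p + e y"
    by (rule dec)+
  \<comment> \<open>The products of two multiples of \<open>p\<close> cancel. Each surviving term
    contains one of \<open>f\<close>, \<open>g\<close>, \<open>e x\<close>, \<open>e y\<close>, and
    hence a factor \<open>\<delta>\<close>.\<close>
  have "X *\<^sub>R (A *v y) - Y *\<^sub>R (A *v x)
      = f *\<^sub>R (A *v y) - g *\<^sub>R (A *v x) + (X - f) *\<^sub>R e y - (Y - g) *\<^sub>R e x"
    unfolding Ax Ay XY by (simp add: algebra_simps)
  also have "norm \<dots> \<le> norm (f *\<^sub>R (A *v y)) + norm (g *\<^sub>R (A *v x))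
      + norm ((X - f) *\<^sub>R e y) + norm ((Y - g) *\<^sub>R e x)"
    by (smt (verit) norm_triangle_ineq norm_triangle_ineq4)
  also have "\<dots> \<le> d * (\<delta> * norm x) * Y + d * (\<delta> * norm y) * X
      + (X + d * (\<delta> * norm x)) * (\<delta> * norm y) + (Y + d * (\<delta> * norm y)) * (\<delta> * norm x)"
  proof -
    have "\<bar>X - f\<bar> \<le> X + d * (\<delta> * norm x)" "\<bar>Y - g\<bar> \<le> Y + d * (\<delta> * norm y)"
      using fg pos by linarith+
    moreover have "norm (A *v x) \<le> X" "norm (A *v y) \<le> Y" using x y by (simp_all add: X_def Y_def)
    moreover have "0 \<le> d * (\<delta> * norm x)" "0 \<le> d * (\<delta> * norm y)" using pos \<delta> by simp_all
    ultimately show ?thesis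
      unfolding norm_scaleR using fg pos e[of x] e[of y]
      by (intro add_mono mult_mono) (simp_all add: add_nonneg_nonneg)
  qed
  also have "\<dots> = (1 + d) * \<delta> * (norm x * Y + norm y * X) + 2 * d * \<delta> * (norm x * (\<delta> * norm y))"
    by (simp add: algebra_simps)
  \<comment> \<open>In the term quadratic in \<open>\<delta>\<close>, one factor is replaced by its
    bound \<open>D\<close>.\<close>
  also have "\<dots> \<le> (1 + d) * \<delta> * (norm x * Y + norm y * X)
      + 2 * d * \<delta> * (D * (norm x * Y + norm y * X))"
  proof (intro add_left_mono mult_left_mono)
    have "norm y \<le> Y" using y by (simp add: Y_def)
    then have "norm x * (\<delta> * norm y) \<le> norm x * (D * Y)"
      using \<delta> pos by (intro mult_left_mono mult_mono) simp_all
    also have "\<dots> \<le> D * (norm x * Y + norm y * X)"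
      using pos by (simp add: algebra_simps)
    finally show "norm x * (\<delta> * norm y) \<le> D * (norm x * Y + norm y * X)" .
  qed (use pos \<delta> in simp)
  also have "\<dots> = (1 + (1 + 2 * D) * d) * \<delta> * (norm x * Y + norm y * X)"
    by (simp add: algebra_simps)
  finally show ?thesis by (simp only: X_def Y_def d_def)
qed

text \<open>In the application, \<open>mono\<close> expresses that no column vanishes and
  \<open>M1\<close> that no row does. The former gives \<open>1 \<le> T n\<close>, the latter that
  \<open>T\<close> is nondecreasing.\<close>

lemma exponential_alignment:
  fixes A M :: "nat \<Rightarrow> real ^ 'n ^ 'n"
  assumes step: "\<And>n. A (Suc n) = A n ** M n"
    and nonneg: "\<And>n x. x \<in> nonneg_orthant \<Longrightarrow> A n *v x \<in> nonneg_orthant"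
    and mono: "\<And>n x. x \<in> nonneg_orthant \<Longrightarrow> coord_sum x \<le> coord_sum (A n *v x)"
    and M1: "\<And>n i. 1 \<le> (M n *v 1) $ i"
    and growth: "\<And>n. coord_sum (M n *v 1) \<le> G * s ^ n"
    and contr: "\<And>n. \<exists>v. norm v = 1 \<and> (\<forall>x. x \<bullet> v = 0 \<longrightarrow> norm (A n *v x) \<le> D * q ^ n * norm x)"
    and qs: "0 < q" "1 \<le> s" "q * s < 1" and DG: "0 \<le> D" "0 \<le> G"
  obtains u C where "u \<in> nonneg_orthant" "coord_sum u = 1"
    "(\<lambda>n. (1 / coord_sum (A n *v 1)) *\<^sub>R (A n *v 1)) \<longlonglongrightarrow> u"
    "0 < C" "\<And>n i. norm (A n *v axis i 1 - coord_sum (A n *v axis i 1) *\<^sub>R u) \<le> C * (q * s) ^ n"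
proof -
  define d where "d = real CARD('n)"
  define r where "r = q * s"
  define T where "T n = coord_sum (A n *v 1)" for n
  define a where "a n = (1 / T n) *\<^sub>R (A n *v 1)" for n
  define K where "K = 1 + (1 + 2 * D) * d"
  have r: "0 < r" "r < 1" "q \<le> r" using qs by (auto simp: r_def)
  then have "q < 1" by linarith
  have d: "1 \<le> d" by (simp add: d_def Suc_le_eq)
  have K: "1 \<le> K" using d DG by (simp add: K_def)
  have sum1: "coord_sum (1 :: real ^ 'n) = d" by (simp add: coord_sum_def d_def)
  have T1: "1 \<le> T n" for n
    using mono[OF nonneg_orthant_simps(1), of n] d by (simp add: T_def sum1)
  have T0: "0 < T n" for n using T1[of n] by linarith
  have A1: "A (Suc n) *v 1 = A n *v (M n *v 1)" for n
    by (simp add: step matrix_vector_mul_assoc)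
  have M1': "M n *v 1 \<in> nonneg_orthant" "M n *v 1 - 1 \<in> nonneg_orthant" for n
    using M1[of n] by (auto simp: nonneg_orthant_def intro: order_trans[OF zero_le_one])
  have Tmono: "T n \<le> T (Suc n)" for n
  proof -
    have "0 \<le> coord_sum (A n *v (M n *v 1 - 1))"
      by (intro coord_sum_nonneg nonneg M1')
    then show ?thesis by (simp add: T_def A1 matrix_vector_mult_diff_distrib coord_sum_simps)
  qed
  then have Tmono': "T n \<le> T (n + j)" for n j
    by (simp add: lift_Suc_mono_le[of T n "n + j"])
  have pair: "norm (coord_sum (A n *v x) *\<^sub>R (A n *v y) - coord_sum (A n *v y) *\<^sub>R (A n *v x))
      \<le> K * (D * q ^ n) * (coord_sum x * coord_sum (A n *v y) + coord_sum y * coord_sum (A n *v x))"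
    if xy: "x \<in> nonneg_orthant" "y \<in> nonneg_orthant" for n x y
  proof -
    obtain v where v: "norm v = 1" "\<And>x. x \<bullet> v = 0 \<Longrightarrow> norm (A n *v x) \<le> D * q ^ n * norm x"
      using contr by blast
    have Dq: "0 \<le> D * q ^ n" "D * q ^ n \<le> D"
      using DG qs \<open>q < 1\<close> by (auto intro!: mult_left_le power_le_one)
    note n = norm_le_coord_sum[OF xy(1)] norm_le_coord_sum[OF xy(2)]
      norm_le_coord_sum[OF nonneg[OF xy(1), of n]] norm_le_coord_sum[OF nonneg[OF xy(2), of n]]
      coord_sum_nonneg[OF nonneg[OF xy(1), of n]] coord_sum_nonneg[OF nonneg[OF xy(2), of n]]
    have "norm (coord_sum (A n *v x) *\<^sub>R (A n *v y) - coord_sum (A n *v y) *\<^sub>R (A n *v x))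
      \<le> K * (D * q ^ n) * (norm x * coord_sum (A n *v y) + norm y * coord_sum (A n *v x))"
      unfolding K_def d_def
      by (rule nearly_parallel_images[OF v Dq])
         (use n mono[OF xy(1), of n] mono[OF xy(2), of n] in linarith)+
    also have "\<dots> \<le> K * (D * q ^ n) * (coord_sum x * coord_sum (A n *v y) + coord_sum y * coord_sum (A n *v x))"
      using K Dq n by (intro mult_left_mono add_mono mult_right_mono) auto
    finally show ?thesis .
  qed
  define K1 where "K1 = K * D * (d + G)"
  have K1: "0 \<le> K1" using K DG d by (simp add: K1_def)
  have a_step: "norm (a (Suc n) - a n) \<le> K1 * r ^ n / T n" for n
  proof -
    have "T n * T (Suc n) * norm (a (Suc n) - a n) = norm ((T n * T (Suc n)) *\<^sub>R (a (Suc n) - a n))"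
      using T0[of n] T0[of "Suc n"] by simp
    \<comment> \<open>Clearing denominators turns the difference of directions into the cross
      difference of \<open>pair\<close>, taken for \<open>1\<close> and
      \<open>M n *v 1\<close>.\<close>
    also have "(T n * T (Suc n)) *\<^sub>R (a (Suc n) - a n) = T n *\<^sub>R (A (Suc n) *v 1) - T (Suc n) *\<^sub>R (A n *v 1)"
      using T0[of n] T0[of "Suc n"] by (simp add: a_def scaleR_diff_right)
    also have "norm \<dots> \<le> K * (D * q ^ n) * (d * T (Suc n) + coord_sum (M n *v 1) * T n)"
      using pair[OF nonneg_orthant_simps(1) M1'(1), of n] by (simp add: T_def A1 sum1)
    also have "\<dots> \<le> K * (D * q ^ n) * (d * T (Suc n) + (G * s ^ n) * T (Suc n))"
      using K DG qs d Tmono[of n] T0[of n] growth[of n] coord_sum_nonneg[OF M1'(1), of n]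
      by (intro mult_left_mono add_mono mult_mono) auto
    also have "\<dots> = T (Suc n) * (K * D * (d * q ^ n + G * (q ^ n * s ^ n)))"
      by (simp add: algebra_simps)
    \<comment> \<open>The growth of \<open>M n\<close> is absorbed here:
      \<open>q ^ n * s ^ n\<close> is \<open>r ^ n\<close>, and \<open>q \<le> r\<close>.\<close>
    also have "\<dots> \<le> T (Suc n) * (K * D * (d * r ^ n + G * r ^ n))"
      using K DG qs d r T0[of "Suc n"]
      by (intro mult_left_mono add_mono power_mono) (auto simp: r_def power_mult_distrib)
    also have "\<dots> = T (Suc n) * (K1 * r ^ n)" by (simp add: K1_def algebra_simps)
    finally show ?thesis
      using T0[of n] T0[of "Suc n"] by (simp add: field_simps)
  qed
  define K2 where "K2 = K1 / (1 - r)"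
  have K2: "0 \<le> K2" using K1 r by (simp add: K2_def)
  \<comment> \<open>The exact difference \<open>r ^ n - r ^ (n + j)\<close> lets the induction
    close, with \<open>K2\<close> coming from the geometric series. Since \<open>T\<close> is
    nondecreasing, the denominator \<open>T n\<close> survives the summation.\<close>
  have a_diff: "norm (a (n + j) - a n) \<le> K2 * (r ^ n - r ^ (n + j)) / T n" for n j
  proof (induction j)
    case (Suc j)
    have "norm (a (n + Suc j) - a n) \<le> norm (a (Suc (n + j)) - a (n + j)) + norm (a (n + j) - a n)"
      using norm_triangle_ineq[of "a (Suc (n + j)) - a (n + j)" "a (n + j) - a n"] by simp
    also have "\<dots> \<le> K1 * r ^ (n + j) / T n + K2 * (r ^ n - r ^ (n + j)) / T n"
    proof (rule add_mono[OF order_trans[OF a_step] Suc])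
      show "K1 * r ^ (n + j) / T (n + j) \<le> K1 * r ^ (n + j) / T n"
        using Tmono'[of n j] T0[of n] K1 r by (intro divide_left_mono) auto
    qed
    also have "\<dots> = K2 * (r ^ n - r ^ (n + Suc j)) / T n"
    proof -
      have K1_eq: "K1 = K2 * (1 - r)" using r by (simp add: K2_def)
      have "K1 * r ^ (n + j) + K2 * (r ^ n - r ^ (n + j)) = K2 * (r ^ n - r ^ (n + Suc j))"
        unfolding K1_eq by (simp add: algebra_simps)
      then show ?thesis by (metis add_divide_distrib)
    qed
    finally show ?case .
  qed simp
  have a_diff': "norm (a m - a n) \<le> K2 * r ^ n / T n" if "n \<le> m" for m n
  proof -
    have "K2 * (r ^ n - r ^ m) / T n \<le> K2 * r ^ n / T n"
      using K2 r T0[of n] by (intro divide_right_mono mult_left_mono) auto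
    then show ?thesis using a_diff[of n "m - n"] that by simp
  qed
  have "Cauchy a"
  proof (rule CauchyI')
    fix e :: real assume "0 < e"
    have "(\<lambda>n. K2 * r ^ n) \<longlonglongrightarrow> 0"
      using r by (intro tendsto_mult_right_zero LIMSEQ_power_zero) auto
    then have "\<forall>\<^sub>F n in sequentially. K2 * r ^ n < e" using \<open>0 < e\<close> by (rule order_tendstoD)
    then obtain N where N: "K2 * r ^ n < e" if "n \<ge> N" for n
      by (auto simp: eventually_sequentially)
    have "dist (a m) (a n) < e" if "m \<ge> N" "n > m" for m n
    proof -
      have "dist (a m) (a n) \<le> K2 * r ^ m / T m"
        using a_diff'[of m n] that by (simp add: dist_norm norm_minus_commute)
      also have "\<dots> \<le> K2 * r ^ m / 1"
        using T1[of m] K2 r by (intro divide_left_mono) auto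
      also have "\<dots> < e" using N that by simp
      finally show ?thesis .
    qed
    then show "\<exists>N. \<forall>m\<ge>N. \<forall>n>m. dist (a m) (a n) < e" by blast
  qed
  then obtain u where u: "a \<longlonglongrightarrow> u" using Cauchy_convergent_iff convergent_def by blast
  have au: "norm (a n - u) \<le> K2 * r ^ n / T n" for n
  proof -
    have "(\<lambda>m. norm (a m - a n)) \<longlonglongrightarrow> norm (u - a n)" by (intro tendsto_intros u)
    then have "norm (u - a n) \<le> K2 * r ^ n / T n"
      by (rule Lim_bounded[of _ _ n]) (use a_diff' in auto)
    then show ?thesis by (simp add: norm_minus_commute)
  qed
  have "a n \<in> nonneg_orthant" for n
    unfolding a_def using T0[of n]
    by (intro nonneg_orthant_scaleR nonneg nonneg_orthant_simps) auto
  then have u1: "u \<in> nonneg_orthant"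
    using closed_sequentially[OF closed_nonneg_orthant _ u] by blast
  have "coord_sum (a n) = 1" for n
    unfolding a_def coord_sum_simps using T0[of n] by (simp add: T_def)
  then have u2: "coord_sum u = 1"
    using tendsto_coord_sum[OF u] by (simp add: LIMSEQ_const_iff)
  \<comment> \<open>The sum of the two error constants below; the added 1 makes it positive.\<close>
  define C where "C = K * D * (d + 1) + K2 + 1"
  have C: "0 < C"
    unfolding C_def by (intro add_nonneg_pos add_nonneg_nonneg mult_nonneg_nonneg)
      (use K DG d K2 in simp_all)
  have "norm (A n *v axis i 1 - coord_sum (A n *v axis i 1) *\<^sub>R u) \<le> C * r ^ n" for n i
  proof -
    define w where "w = A n *v axis i 1"
    define c where "c = coord_sum w"
    have c0: "0 \<le> c" unfolding c_def w_def by (intro coord_sum_nonneg nonneg nonneg_orthant_simps)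
    \<comment> \<open>The other columns have a nonnegative total, so this column has coordinate sum
      at most \<open>T n\<close>, which cancels the factor \<open>1 / T n\<close> in
      \<open>au\<close>.\<close>
    have "0 \<le> coord_sum (A n *v (1 - axis i 1))"
      by (intro coord_sum_nonneg nonneg nonneg_orthant_simps)
    then have cT: "c \<le> T n"
      by (simp add: c_def w_def T_def matrix_vector_mult_diff_distrib coord_sum_simps)
    have "T n * norm (w - c *\<^sub>R a n) = norm (T n *\<^sub>R (w - c *\<^sub>R a n))"
      using T0[of n] by simp
    also have "T n *\<^sub>R (w - c *\<^sub>R a n) = T n *\<^sub>R w - c *\<^sub>R (A n *v 1)"
      using T0[of n] by (simp add: a_def scaleR_diff_right)
    also have "norm \<dots> \<le> K * (D * q ^ n) * (d * c + coord_sum (axis i 1 :: real ^ 'n) * T n)"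
      using pair[OF nonneg_orthant_simps(1) nonneg_orthant_simps(2)[of i], of n]
      by (simp add: T_def w_def c_def sum1)
    also have "\<dots> \<le> K * (D * r ^ n) * (d * T n + 1 * T n)"
      unfolding coord_sum_axis
      using K DG qs d c0 cT r T0[of n] by (intro mult_mono add_mono mult_left_mono power_mono) auto
    also have "\<dots> = T n * (K * D * (d + 1) * r ^ n)" by (simp add: algebra_simps)
    finally have 1: "norm (w - c *\<^sub>R a n) \<le> K * D * (d + 1) * r ^ n" using T0[of n] by simp
    have "norm (c *\<^sub>R (a n - u)) \<le> T n * (K2 * r ^ n / T n)"
      unfolding norm_scaleR using c0 cT au T0[of n] by (intro mult_mono) auto
    then have 2: "norm (c *\<^sub>R (a n - u)) \<le> K2 * r ^ n" using T0[of n] by simp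
    have "norm (w - c *\<^sub>R u) \<le> norm (w - c *\<^sub>R a n) + norm (c *\<^sub>R (a n - u))"
      using norm_triangle_ineq[of "w - c *\<^sub>R a n" "c *\<^sub>R (a n - u)"] by (simp add: scaleR_diff_right)
    also have "\<dots> \<le> K * D * (d + 1) * r ^ n + K2 * r ^ n" using 1 2 by (rule add_mono)
    also have "\<dots> = (C - 1) * r ^ n" by (simp add: C_def algebra_simps)
    also have "\<dots> \<le> C * r ^ n" using r by (intro mult_right_mono) simp_all
    finally show ?thesis by (simp add: w_def c_def)
  qed
  then show thesis
    using that[OF u1 u2 _ C] u unfolding a_def T_def r_def by blast
qed

subsection \<open>Substitutions and their incidence matrices\<close>

text \<open>The abelianization (Parikh vector) of a word, with real entries so that incidence
  matrices act on it.\<close>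

definition counts :: "'a list \<Rightarrow> real ^ 'a" where
  "counts w = (\<chi> a. real (count_list w a))"

lemma counts_simps:
  "counts [] = 0" "counts (v @ w) = counts v + counts w" "counts [b] = axis b 1"
  by (auto simp: counts_def vec_eq_iff axis_def)

lemma counts_Cons: "counts (b # w) = axis b 1 + counts w"
  using counts_simps(2)[of "[b]" w] by (simp add: counts_simps(3))

lemma counts_nth: "counts w $ a = real (count_list w a)"
  by (simp add: counts_def)

lemma coord_sum_counts: "coord_sum (counts w) = length w"
  by (induction w) (simp_all add: counts_simps(1) counts_Cons coord_sum_simps coord_sum_axis)

lemma substitution_simps:
  assumes "substitution s"
  shows "s [] = []" "s (v @ w) = s v @ s w" "s (a # w) = s [a] @ s w" "s [a] \<noteq> []"
proof -
  show *: "s (v @ w) = s v @ s w" for v w using assms by (simp add: substitution_def)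
  show "s (a # w) = s [a] @ s w" using *[of "[a]" w] by simp
qed (use assms in \<open>simp_all add: substitution_def\<close>)

lemma substitution_comp:
  assumes "substitution s" "substitution t" shows "substitution (s \<circ> t)"
proof -
  have "s (t [a]) \<noteq> []" for a
    using substitution_simps(3,4)[OF assms(1)] substitution_simps(4)[OF assms(2), of a]
    by (metis append_is_Nil_conv neq_Nil_conv)
  then show ?thesis using assms by (simp add: substitution_def)
qed

lemma incidence_matrix_axis: "incidence_matrix s *v axis b 1 = counts (s [b])"
  by (simp add: matrix_vector_mult_basis column_def incidence_matrix_def counts_def)

lemma incidence_matrix_counts:
  assumes "substitution s" shows "incidence_matrix s *v counts w = counts (s w)"
proof (induction w)
  case (Cons b w)
  show ?case
    unfolding substitution_simps(3)[OF assms, of b w] counts_Cons counts_simps(2)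
    by (simp add: matrix_vector_right_distrib incidence_matrix_axis Cons)
qed (simp add: counts_simps substitution_simps[OF assms])

lemma incidence_matrix_comp:
  assumes "substitution s"
  shows "incidence_matrix (s \<circ> t) = incidence_matrix s ** incidence_matrix t"
proof -
  have "(incidence_matrix s ** incidence_matrix t) $ a $ b = incidence_matrix (s \<circ> t) $ a $ b" for a b
  proof -
    have "(incidence_matrix s ** incidence_matrix t) $ a $ b
        = (incidence_matrix s *v counts (t [b])) $ a"
      by (simp add: matrix_matrix_mult_def matrix_vector_mult_def incidence_matrix_def counts_def)
    then show ?thesis
      unfolding incidence_matrix_counts[OF assms] by (simp add: counts_def incidence_matrix_def)
  qed
  then show ?thesis by (simp add: vec_eq_iff)
qed

lemma incidence_matrix_nonneg:
  "x \<in> nonneg_orthant \<Longrightarrow> incidence_matrix s *v x \<in> nonneg_orthant"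
  by (auto simp: nonneg_orthant_def matrix_vector_mult_def incidence_matrix_def intro!: sum_nonneg)

lemma coord_sum_incidence_matrix:
  "coord_sum (incidence_matrix s *v x) = (\<Sum>b\<in>UNIV. length (s [b]) * x $ b)"
proof -
  have "coord_sum (incidence_matrix s *v x)
      = (\<Sum>a\<in>UNIV. \<Sum>b\<in>UNIV. real (count_list (s [b]) a) * x $ b)"
    by (simp add: coord_sum_def matrix_vector_mult_def incidence_matrix_def)
  also have "\<dots> = (\<Sum>b\<in>UNIV. (\<Sum>a\<in>UNIV. real (count_list (s [b]) a)) * x $ b)"
    unfolding sum_distrib_right by (rule sum.swap)
  also have "\<dots> = (\<Sum>b\<in>UNIV. length (s [b]) * x $ b)"
  proof (intro sum.cong refl)
    fix b
    show "(\<Sum>a\<in>UNIV. real (count_list (s [b]) a)) * x $ b = length (s [b]) * x $ b"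
      using coord_sum_counts[of "s [b]"] by (simp add: coord_sum_def counts_def)
  qed
  finally show ?thesis .
qed

text \<open>Images of letters are nonempty, so every column sum is at least 1.\<close>

lemma coord_sum_incidence_matrix_ge:
  assumes "substitution s" "x \<in> nonneg_orthant"
  shows "coord_sum x \<le> coord_sum (incidence_matrix s *v x)"
proof -
  have "1 * x $ b \<le> length (s [b]) * x $ b" for b
    using assms(2) substitution_simps(4)[OF assms(1), of b]
    by (intro mult_right_mono) (auto simp: nonneg_orthant_def Suc_le_eq)
  then show ?thesis unfolding coord_sum_incidence_matrix
    unfolding coord_sum_def by (intro sum_mono) simp
qed

text \<open>A row sum is a natural number, and if it were 0 the zero row would force the determinant
  to vanish.\<close>

lemma incidence_matrix_one_ge:
  assumes "det (incidence_matrix s) \<noteq> 0"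
  shows "1 \<le> (incidence_matrix s *v 1) $ a"
proof -
  let ?k = "\<Sum>b\<in>UNIV. count_list (s [b]) a"
  have k: "(incidence_matrix s *v 1) $ a = real ?k"
    by (simp add: matrix_vector_mult_def incidence_matrix_def)
  have "?k \<noteq> 0"
  proof
    assume "?k = 0"
    then have "row a (incidence_matrix s) = 0"
      by (simp add: row_def incidence_matrix_def vec_eq_iff)
    then show False using assms det_zero_row(1) by blast
  qed
  then have "1 \<le> ?k" by linarith
  then show ?thesis unfolding k by (metis of_nat_1 of_nat_mono)
qed

section \<open>Blocks of composed substitutions\<close>

lemma block_refl: "block \<sigma> m m = id"
  by (simp add: block_def)

lemma block_Suc:
  assumes "m \<le> n" shows "block \<sigma> m (n + 1) = block \<sigma> m n \<circ> \<sigma> n"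
proof -
  \<comment> \<open>The right fold in \<open>block\<close> ends in \<open>id\<close>; a factor
    appended on the right becomes the new end value, which is split off as a composition.\<close>
  have *: "foldr (\<circ>) fs g = foldr (\<circ>) fs id \<circ> g" for fs and g :: "'a list \<Rightarrow> 'a list"
    by (induction fs) (simp_all add: comp_assoc)
  have "map \<sigma> [m..n] = map \<sigma> [m..n - 1] @ [\<sigma> n]"
    using assms by (simp add: upto_rec2)
  then show ?thesis using *[of "map \<sigma> [m..n - 1]" "\<sigma> n"] by (simp add: block_def)
qed

lemma block_append:
  assumes "m \<le> k" "k \<le> n" shows "block \<sigma> m n = block \<sigma> m k \<circ> block \<sigma> k n"
  using assms(2)
proof (induction n rule: int_ge_induct)
  case (step n)
  then show ?case using assms(1) by (simp add: block_Suc comp_assoc)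
qed (simp add: block_refl)

lemma substitution_block:
  assumes "\<And>n. substitution (\<sigma> n)" shows "substitution (block \<sigma> m n)"
proof (cases "m \<le> n")
  case True
  then show ?thesis
  proof (induction n rule: int_ge_induct)
    case base
    then show ?case by (simp add: block_refl substitution_def)
  next
    case (step n)
    then show ?case by (simp only: block_Suc substitution_comp assms)
  qed
qed (simp add: block_def substitution_def)

lemma incidence_matrix_block_Suc:
  assumes "\<And>n. substitution (\<sigma> n)"
  shows "incidence_matrix (block \<sigma> 0 (int (Suc n)))
    = incidence_matrix (block \<sigma> 0 (int n)) ** incidence_matrix (\<sigma> (int n))"
  using block_Suc[of 0 "int n" \<sigma>]
  by (simp add: incidence_matrix_comp substitution_block[OF assms] add.commute)

lemma incidence_matrix_id: "incidence_matrix id = mat 1"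
  by (auto simp: incidence_matrix_def mat_def vec_eq_iff)

lemma det_block_nonzero:
  fixes \<sigma> :: "int \<Rightarrow> 'a::finite list \<Rightarrow> 'a list"
  assumes "\<And>n. \<sigma> n \<in> unimodular_substitutions"
  shows "det (incidence_matrix (block \<sigma> 0 (int n))) \<noteq> 0"
proof (induction n)
  case (Suc n)
  have s: "\<And>n. substitution (\<sigma> n)" and "\<bar>det (incidence_matrix (\<sigma> (int n)))\<bar> = 1"
    using assms by (simp_all add: unimodular_substitutions_def)
  then have "det (incidence_matrix (\<sigma> (int n))) \<noteq> 0" by linarith
  with Suc show ?case by (simp add: incidence_matrix_block_Suc[OF s] det_mul del: of_nat_Suc)
qed (simp add: block_refl incidence_matrix_id del: id_apply)

section \<open>Geometric bounds from the norm, growth and Pisot conditions\<close>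

text \<open>\<open>N\<close> is Lipschitz for the Euclidean norm, hence attains a positive minimum
  on the unit sphere; \<open>c\<close> is its reciprocal.\<close>

lemma norm_le_is_norm:
  fixes N :: "'v::euclidean_space \<Rightarrow> real"
  assumes N: "is_norm N"
  obtains c where "0 < c" "\<And>x. norm x \<le> c * N x"
proof -
  have N0: "N 0 = 0" and Npos: "0 \<le> N x" and Neq: "N x = 0 \<longleftrightarrow> x = 0"
    and Nscale: "N (t *\<^sub>R x) = \<bar>t\<bar> * N x" and Nadd: "N (x + y) \<le> N x + N y" for x y t
    using N by (auto simp: is_norm_def)
  have Nsum: "N (sum f B) \<le> (\<Sum>b\<in>B. N (f b))" if "finite B" for f :: "'v \<Rightarrow> 'v" and B
    using that by (induction B) (auto simp: N0 intro: order_trans[OF Nadd])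
  define L where "L = (\<Sum>b\<in>(Basis::'v set). N b)"
  have NL: "N x \<le> L * norm x" for x
  proof -
    have "N x = N (\<Sum>b\<in>Basis. (x \<bullet> b) *\<^sub>R b)" by (simp add: euclidean_representation)
    also have "\<dots> \<le> (\<Sum>b\<in>Basis. \<bar>x \<bullet> b\<bar> * N b)"
      using Nsum[OF finite_Basis, of "\<lambda>b. (x \<bullet> b) *\<^sub>R b"] by (simp only: Nscale)
    also have "\<dots> \<le> (\<Sum>b\<in>Basis. norm x * N b)"
      by (intro sum_mono mult_right_mono Basis_le_norm Npos)
    finally show ?thesis by (simp add: L_def sum_distrib_left mult.commute)
  qed
  have Nminus: "N (- x) = N x" for x using Nscale[of "-1" x] by simp
  have lip: "dist (N x) (N y) \<le> L * dist x y" for x y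
  proof -
    have "N x \<le> N (x - y) + N y" "N y \<le> N (y - x) + N x"
      using Nadd[of "x - y" y] Nadd[of "y - x" x] by simp_all
    then show ?thesis
      using NL[of "x - y"] Nminus[of "x - y"] by (simp add: dist_norm abs_le_iff)
  qed
  have "0 \<le> L" by (simp add: L_def sum_nonneg Npos)
  then have "continuous_on (sphere 0 1) N"
    using lip by (intro lipschitz_on_continuous_on[of L] lipschitz_onI) auto
  moreover obtain b :: 'v where "b \<in> Basis" using nonempty_Basis by blast
  then have "sphere (0::'v) 1 \<noteq> {}" by force
  ultimately obtain z where z: "z \<in> sphere 0 1" "\<forall>y\<in>sphere 0 1. N z \<le> N y"
    using continuous_attains_inf[OF compact_sphere] by blast
  have "z \<noteq> 0" using z(1) by force
  then have Nz: "0 < N z" using Npos[of z] Neq[of z] by linarith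
  have "norm x \<le> (1 / N z) * N x" for x
  proof (cases "x = 0")
    case False
    then have "N z \<le> N ((1 / norm x) *\<^sub>R x)" using z(2) by simp
    then have "N z \<le> N x / norm x" by (simp add: Nscale)
    then show ?thesis using False Nz by (simp add: field_simps)
  qed (simp add: N0)
  then show thesis using that[of "1 / N z"] Nz by simp
qed

text \<open>The finitely many exceptional indices are absorbed into \<open>G\<close>. This turns
  asymptotic hypotheses into bounds for every \<open>n\<close>.\<close>

lemma eventually_le_imp_bounded:
  fixes f h :: "nat \<Rightarrow> real"
  assumes ev: "\<forall>\<^sub>F n in sequentially. f n \<le> h n" and h: "\<And>n. 0 < h n"
  obtains G where "0 \<le> G" "\<And>n. f n \<le> G * h n"
proof -
  obtain m where m: "f n \<le> h n" if "n \<ge> m" for n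
    using ev by (auto simp: eventually_sequentially)
  define G where "G = 1 + (\<Sum>k<m. \<bar>f k\<bar> / h k)"
  have G: "1 \<le> G" unfolding G_def using h by (simp add: sum_nonneg less_imp_le)
  have "f n \<le> G * h n" for n
  proof (cases "n < m")
    case True
    then have "\<bar>f n\<bar> / h n \<le> (\<Sum>k<m. \<bar>f k\<bar> / h k)"
      using h by (intro member_le_sum) (auto simp: less_imp_le)
    then have "\<bar>f n\<bar> / h n \<le> G" by (simp add: G_def)
    then show ?thesis using h[of n] by (simp add: field_simps)
  next
    case False
    then show ?thesis using m[of n] mult_right_mono[OF G less_imp_le[OF h[of n]]] by simp
  qed
  then show thesis using that[of G] G by simp
qed

text \<open>Subexponential growth admits every base \<open>s > 1\<close>, a freedom needed to fit
  \<open>s\<close> to the contraction rate later.\<close>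

lemma growth_condition_bound:
  fixes \<sigma> :: "int \<Rightarrow> 'a::finite list \<Rightarrow> 'a list" and N :: "real ^ 'a ^ 'a \<Rightarrow> real"
  assumes N: "is_norm N" and growth: "growth_condition N \<sigma>"
    and det: "\<And>n. det (incidence_matrix (\<sigma> n)) \<noteq> 0" and s: "1 < s"
  obtains G where "0 \<le> G" "\<And>n. coord_sum (incidence_matrix (\<sigma> (int n)) *v 1) \<le> G * s ^ n"
proof -
  let ?M = "\<lambda>n::nat. incidence_matrix (\<sigma> (int n))"
  have "0 < ln s" using s by simp
  then have "\<forall>\<^sub>F n in sequentially. ln (N (?M n)) / real n < ln s"
    using growth unfolding growth_condition_def by (rule order_tendstoD(2)[rotated])
  then have "\<forall>\<^sub>F n in sequentially. N (?M n) \<le> s ^ n"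
    using eventually_gt_at_top[of 0]
  proof eventually_elim
    case (elim n)
    \<comment> \<open>A matrix of nonzero determinant is nonzero, so its norm is positive and the
      logarithm can be undone.\<close>
    have "det (0 :: real ^ 'a ^ 'a) = 0" by (rule det_zero_row(1)) (simp add: row_def vec_eq_iff)
    then have "?M n \<noteq> 0" using det[of "int n"] by metis
    then have "0 < N (?M n)" using N by (metis is_norm_def order_le_less)
    moreover have "ln (N (?M n)) \<le> ln (s ^ n)"
      using elim s by (simp add: field_simps ln_realpow)
    ultimately show ?case using s by simp
  qed
  then obtain G where G: "0 \<le> G" "\<And>n. N (?M n) \<le> G * s ^ n"
    by (rule eventually_le_imp_bounded) (use s in auto)
  obtain c where c: "0 < c" "\<And>x. norm x \<le> c * N x"
    using norm_le_is_norm[OF N] by blast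
  define d where "d = real CARD('a)"
  have "coord_sum (?M n *v 1) \<le> (d * d * c * G) * s ^ n" for n
  proof -
    have "coord_sum (?M n *v 1) = (\<Sum>a\<in>UNIV. \<Sum>b\<in>UNIV. ?M n $ a $ b)"
      by (simp add: coord_sum_def matrix_vector_mult_def)
    also have "\<dots> \<le> (\<Sum>a\<in>(UNIV::'a set). \<Sum>b\<in>(UNIV::'a set). norm (?M n))"
    proof (intro sum_mono)
      fix a b
      have "?M n $ a $ b \<le> norm (?M n $ a)"
        using component_le_norm_cart[of "?M n $ a" b] by linarith
      also have "\<dots> \<le> norm (?M n)" by (rule Finite_Cartesian_Product.norm_nth_le)
      finally show "?M n $ a $ b \<le> norm (?M n)" .
    qed
    also have "\<dots> = d * d * norm (?M n)" by (simp add: d_def)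
    also have "\<dots> \<le> d * d * (c * (G * s ^ n))"
    proof (rule mult_left_mono)
      show "norm (?M n) \<le> c * (G * s ^ n)"
        using order_trans[OF c(2) mult_left_mono[OF G(2)]] c(1) by simp
    qed (simp add: d_def)
    finally show ?thesis by (simp add: mult.assoc)
  qed
  then show thesis using that[of "d * d * c * G"] G(1) c(1) by (simp add: d_def)
qed

text \<open>A limit superior strictly below 0 leaves room for a real \<open>y < 0\<close> above it,
  and \<open>q = exp y\<close>.\<close>

lemma local_Pisot_bound:
  assumes "local_Pisot \<sigma>"
  obtains D q where "0 \<le> D" "0 < q" "q < 1"
    "\<And>n. singular_value 2 (incidence_matrix (block \<sigma> 0 (int n))) \<le> D * q ^ n"
proof -
  define \<delta> where "\<delta> n = singular_value 2 (incidence_matrix (block \<sigma> 0 (int n)))" for n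
  have "limsup (\<lambda>n. ereal (ln (\<delta> n) / real n)) < 0"
    using assms by (simp add: local_Pisot_def \<delta>_def)
  then obtain y where y: "limsup (\<lambda>n. ereal (ln (\<delta> n) / real n)) < ereal y" "ereal y < 0"
    using ereal_dense2 by blast
  have "\<forall>\<^sub>F n in sequentially. ereal (ln (\<delta> n) / real n) < ereal y"
    using y(1) by (rule Limsup_lessD)
  then have "\<forall>\<^sub>F n in sequentially. \<delta> n \<le> exp y ^ n"
    using eventually_gt_at_top[of 0]
  proof eventually_elim
    case (elim n)
    show ?case
    proof (cases "0 < \<delta> n")
      case True
      have "ln (\<delta> n) \<le> real n * y" using elim by (simp add: field_simps)
      then have "\<delta> n \<le> exp (real n * y)" using True by (metis exp_le_cancel_iff exp_ln)
      then show ?thesis by (simp add: exp_of_nat_mult)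
    next
      \<comment> \<open>Here the logarithm carries no information, but a nonpositive number lies
        below any positive power.\<close>
      case False
      then show ?thesis by (meson exp_gt_zero less_imp_le not_less order_trans zero_le_power)
    qed
  qed
  then obtain D where "0 \<le> D" "\<And>n. \<delta> n \<le> D * exp y ^ n"
    by (rule eventually_le_imp_bounded) auto
  then show thesis using that[of D "exp y"] y(2) by (simp add: \<delta>_def)
qed

subsection \<open>The limit direction and the discrepancy of words\<close>

text \<open>For \<open>coord_sum u = 1\<close> this is the projection of the abelianization along
  \<open>u\<close> to the hyperplane of coordinate sum 0.\<close>

definition discrepancy :: "real ^ 'a \<Rightarrow> 'a list \<Rightarrow> real ^ 'a" where
  "discrepancy u w = counts w - real (length w) *\<^sub>R u"

lemma discrepancy_simps:
  "discrepancy u [] = 0" "discrepancy u (v @ w) = discrepancy u v + discrepancy u w"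
  by (simp_all add: discrepancy_def counts_simps algebra_simps)

lemma limit_direction:
  fixes \<sigma> :: "int \<Rightarrow> 'a::finite list \<Rightarrow> 'a list" and N :: "real ^ 'a ^ 'a \<Rightarrow> real"
  assumes card: "CARD('a) \<ge> 2" and uni: "\<And>n. \<sigma> n \<in> unimodular_substitutions"
    and Pisot: "local_Pisot \<sigma>" and N: "is_norm N" "growth_condition N \<sigma>"
  obtains u C G r s where "u \<in> nonneg_orthant" "coord_sum u = 1"
    "(\<lambda>n::nat. (1 / coord_sum (incidence_matrix (block \<sigma> 0 (int n)) *v 1))
        *\<^sub>R (incidence_matrix (block \<sigma> 0 (int n)) *v 1)) \<longlonglongrightarrow> u"
    "0 < C" "\<And>n i. norm (discrepancy u (block \<sigma> 0 (int n) [i])) \<le> C * r ^ n"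
    "0 \<le> G" "\<And>n b. real (length (\<sigma> (int n) [b])) \<le> G * s ^ n"
    "0 < r" "1 < s" "r * s < 1"
proof -
  have sub: "substitution (\<sigma> n)" for n
    using uni by (simp add: unimodular_substitutions_def)
  have det: "det (incidence_matrix (\<sigma> n)) \<noteq> 0" for n
    using uni[of n] by (auto simp: unimodular_substitutions_def)
  obtain D q where D: "0 \<le> D" and q: "0 < q" "q < 1"
    and Dq: "\<And>n. singular_value 2 (incidence_matrix (block \<sigma> 0 (int n))) \<le> D * q ^ n"
    using local_Pisot_bound[OF Pisot] by blast
  \<comment> \<open>That is \<open>q\<close> to the power -1/3, so that even
    \<open>q * s * s < 1\<close>: one factor \<open>s\<close> is spent on the rate
    \<open>r = q * s\<close>, the other is reserved for the lengths of the images of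
    letters.\<close>
  define s where "s = exp (- ln q / 3)"
  have "ln q < 0" using q by simp
  then have s: "1 < s" by (simp add: s_def)
  have "q * s * s = exp (ln q + (- ln q / 3) + (- ln q / 3))"
    unfolding exp_add s_def using q by simp
  also have "\<dots> < 1" using \<open>ln q < 0\<close> by simp
  finally have qss: "q * s * s < 1" .
  have "q * s * 1 \<le> q * s * s" using q s by (intro mult_left_mono) auto
  then have qs: "q * s < 1" using qss by linarith
  obtain G where G: "0 \<le> G" "\<And>n. coord_sum (incidence_matrix (\<sigma> (int n)) *v 1) \<le> G * s ^ n"
    using growth_condition_bound[OF N det s] by blast
  have contr: "\<exists>v. norm v = 1 \<and> (\<forall>x. x \<bullet> v = 0 \<longrightarrow>
      norm (incidence_matrix (block \<sigma> 0 (int n)) *v x) \<le> D * q ^ n * norm x)" for n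
  proof -
    obtain v where v: "norm v = 1" "\<And>x. x \<bullet> v = 0 \<Longrightarrow>
        norm (incidence_matrix (block \<sigma> 0 (int n)) *v x)
          \<le> singular_value 2 (incidence_matrix (block \<sigma> 0 (int n))) * norm x"
      using second_singular_value_bound[OF card] by blast
    have "norm (incidence_matrix (block \<sigma> 0 (int n)) *v x) \<le> D * q ^ n * norm x"
      if "x \<bullet> v = 0" for x
      using v(2)[OF that] mult_right_mono[OF Dq[of n] norm_ge_zero[of x]] by linarith
    with v(1) show ?thesis by blast
  qed
  obtain u C where u: "u \<in> nonneg_orthant" "coord_sum u = 1"
    "(\<lambda>n::nat. (1 / coord_sum (incidence_matrix (block \<sigma> 0 (int n)) *v 1))
        *\<^sub>R (incidence_matrix (block \<sigma> 0 (int n)) *v 1)) \<longlonglongrightarrow> u"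
    "0 < C" and close: "\<And>(n::nat) i. norm (incidence_matrix (block \<sigma> 0 (int n)) *v axis i 1
      - coord_sum (incidence_matrix (block \<sigma> 0 (int n)) *v axis i 1) *\<^sub>R u) \<le> C * (q * s) ^ n"
    by (rule exponential_alignment[OF incidence_matrix_block_Suc[OF sub] incidence_matrix_nonneg
          coord_sum_incidence_matrix_ge[OF substitution_block[OF sub]] incidence_matrix_one_ge[OF det]
          G(2) contr q(1) less_imp_le[OF s] qs D G(1)]) (assumption | rule that)+
  have "real (length (\<sigma> (int n) [b])) \<le> G * s ^ n" for n b
  proof -
    have "real (length (\<sigma> (int n) [b])) \<le> (\<Sum>b\<in>UNIV. real (length (\<sigma> (int n) [b])))"
      by (rule member_le_sum) auto
    also have "\<dots> = coord_sum (incidence_matrix (\<sigma> (int n)) *v 1)"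
      by (simp add: coord_sum_incidence_matrix)
    finally show ?thesis using G(2)[of n] by linarith
  qed
  moreover have "norm (discrepancy u (block \<sigma> 0 (int n) [i])) \<le> C * (q * s) ^ n" for n i
    using close[of n i]
    by (simp add: discrepancy_def incidence_matrix_axis coord_sum_counts)
  ultimately show thesis
    using that[OF u _ G(1) _ _ s qss] q s by simp
qed

text \<open>The ray lies in each cone because the cones are nested and closed. Conversely, a point
  \<open>x\<close> of the \<open>n\<close>-th cone is a nonnegative combination of columns, so its
  deviation from the ray is at most \<open>coord_sum x * e n\<close>, which tends to 0.\<close>

lemma generalized_right_eigenvector_limit:
  fixes \<sigma> :: "int \<Rightarrow> 'a::finite list \<Rightarrow> 'a list"
  assumes uni: "\<And>n. \<sigma> n \<in> unimodular_substitutions"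
    and u: "u \<in> nonneg_orthant" "coord_sum u = 1"
    and lim: "(\<lambda>n::nat. (1 / coord_sum (incidence_matrix (block \<sigma> 0 (int n)) *v 1))
        *\<^sub>R (incidence_matrix (block \<sigma> 0 (int n)) *v 1)) \<longlonglongrightarrow> u"
    and close: "\<And>n i. norm (discrepancy u (block \<sigma> 0 (int n) [i])) \<le> e n" and e: "e \<longlonglongrightarrow> 0"
  shows "generalized_right_eigenvector \<sigma> u"
proof -
  have sub: "substitution (\<sigma> n)" for n
    using uni by (simp add: unimodular_substitutions_def)
  define A where "A n = incidence_matrix (block \<sigma> 0 (int n))" for n
  have A_ge: "x \<in> nonneg_orthant \<Longrightarrow> coord_sum x \<le> coord_sum (A n *v x)" for n x
    unfolding A_def by (intro coord_sum_incidence_matrix_ge substitution_block sub)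
  have ray_subset: "t *\<^sub>R u \<in> (*v) (A n) ` nonneg_orthant" if "0 \<le> t" for t n
  proof -
    obtain B where B: "A n ** B = mat 1" "B ** A n = mat 1"
      using det_block_nonzero[of \<sigma>, OF uni, of n] unfolding A_def invertible_det_nz[symmetric] invertible_def
      by blast
    define a where "a m = (1 / coord_sum (A m *v 1)) *\<^sub>R (A m *v 1)" for m
    have "(\<lambda>m. B *v a m) \<longlonglongrightarrow> B *v u"
      using lim unfolding a_def A_def
      by (intro bounded_linear.tendsto[OF matrix_vector_mul_bounded_linear])
    \<comment> \<open>For \<open>m \<ge> n\<close> the inverse \<open>B\<close> cancels the first
      \<open>n\<close> factors of \<open>A m\<close> and leaves a nonnegative matrix.\<close>
    moreover have "B *v a m \<in> nonneg_orthant" if "n \<le> m" for m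
    proof -
      let ?x = "incidence_matrix (block \<sigma> (int n) (int m)) *v 1"
      have "A m = A n ** incidence_matrix (block \<sigma> (int n) (int m))"
        using that block_append[of 0 "int n" "int m" \<sigma>]
        by (simp add: A_def incidence_matrix_comp substitution_block[OF sub])
      then have "B *v (A m *v 1) = ?x"
        by (simp add: matrix_vector_mul_assoc matrix_mul_assoc B)
      moreover have "0 \<le> coord_sum (A m *v 1)"
        unfolding A_def by (intro coord_sum_nonneg incidence_matrix_nonneg nonneg_orthant_simps)
      ultimately show ?thesis
        unfolding a_def matrix_vector_mult_scaleR
        by (simp add: nonneg_orthant_scaleR incidence_matrix_nonneg nonneg_orthant_simps)
    qed
    ultimately have "B *v u \<in> nonneg_orthant"
      using Lim_in_closed_set[OF closed_nonneg_orthant]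
      by (metis (no_types, lifting) eventually_sequentially trivial_limit_sequentially)
    then have "t *\<^sub>R (B *v u) \<in> nonneg_orthant" using that by (rule nonneg_orthant_scaleR)
    moreover have "A n *v (t *\<^sub>R (B *v u)) = t *\<^sub>R u"
      by (simp add: matrix_vector_mult_scaleR matrix_vector_mul_assoc B)
    ultimately show ?thesis by (metis image_eqI)
  qed
  have subset_ray: "\<exists>t\<ge>0. x = t *\<^sub>R u" if x: "\<And>n. x \<in> (*v) (A n) ` nonneg_orthant" for x
  proof -
    have bound: "norm (x - coord_sum x *\<^sub>R u) \<le> coord_sum x * e n" for n
    proof -
      obtain y where y: "y \<in> nonneg_orthant" "x = A n *v y" using x by blast
      have "x = (\<Sum>i\<in>UNIV. y $ i *\<^sub>R counts (block \<sigma> 0 (int n) [i]))"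
        unfolding y(2) by (subst matrix_mult_sum)
          (simp add: A_def column_def incidence_matrix_def counts_def scalar_mult_eq_scaleR)
      moreover have "coord_sum x = (\<Sum>i\<in>UNIV. y $ i * length (block \<sigma> 0 (int n) [i]))"
        unfolding y(2) A_def coord_sum_incidence_matrix by (simp add: mult.commute)
      ultimately have "x - coord_sum x *\<^sub>R u
          = (\<Sum>i\<in>UNIV. y $ i *\<^sub>R discrepancy u (block \<sigma> 0 (int n) [i]))"
        by (simp add: discrepancy_def scaleR_diff_right sum_subtractf scaleR_left.sum)
      also have "norm \<dots> \<le> (\<Sum>i\<in>UNIV. y $ i * e n)"
        using y(1) close by (intro sum_norm_le) (auto simp: nonneg_orthant_def intro: mult_left_mono)
      also have "\<dots> = coord_sum y * e n" by (simp add: coord_sum_def sum_distrib_right)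
      \<comment> \<open>The coefficients \<open>y\<close> depend on \<open>n\<close>, but their sum
        never exceeds \<open>coord_sum x\<close>.\<close>
      also have "\<dots> \<le> coord_sum x * e n"
        using A_ge[OF y(1), of n] order_trans[OF norm_ge_zero close[of n]]
        unfolding y(2) by (intro mult_right_mono) auto
      finally show ?thesis .
    qed
    have "(\<lambda>n. coord_sum x * e n) \<longlonglongrightarrow> 0" using e by (rule tendsto_mult_right_zero)
    then have "norm (x - coord_sum x *\<^sub>R u) \<le> 0"
      by (rule Lim_bounded2[of _ _ 0]) (use bound in auto)
    moreover have "x \<in> nonneg_orthant" using x[of 0] by (auto simp: A_def incidence_matrix_nonneg)
    ultimately show ?thesis using coord_sum_nonneg by auto
  qed
  have "(\<Inter>n. (*v) (A n) ` nonneg_orthant) = {t *\<^sub>R u | t. 0 \<le> t}"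
  proof (intro subset_antisym subsetI)
    fix x assume "x \<in> (\<Inter>n. (*v) (A n) ` nonneg_orthant)"
    then have "\<And>n. x \<in> (*v) (A n) ` nonneg_orthant" by blast
    then show "x \<in> {t *\<^sub>R u | t. 0 \<le> t}" using subset_ray by blast
  qed (use ray_subset in blast)
  moreover have "u \<noteq> 0" using u(2) by (auto simp: coord_sum_simps)
  ultimately show ?thesis using u(1) by (simp add: generalized_right_eigenvector_def A_def)
qed

text \<open>Distances to the line depend on \<open>u\<close> only through its span, so convergence
  passes from the constructed vector to any other.\<close>

lemma generalized_right_eigenvector_unique:
  assumes "generalized_right_eigenvector \<sigma> u" "generalized_right_eigenvector \<sigma> v"
  shows "range (\<lambda>t. t *\<^sub>R u) = range (\<lambda>t. t *\<^sub>R v)"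
proof -
  have eq: "{t *\<^sub>R u | t. 0 \<le> t} = {t *\<^sub>R v | t. 0 \<le> t}" and nz: "u \<noteq> 0"
    using assms by (auto simp: generalized_right_eigenvector_def)
  have "u = 1 *\<^sub>R u" by simp
  then have "u \<in> {t *\<^sub>R u | t. 0 \<le> t}" using zero_le_one by blast
  then obtain c where c: "u = c *\<^sub>R v" using eq by auto
  with nz have "c \<noteq> 0" by auto
  show ?thesis
  proof (intro subset_antisym image_subsetI)
    show "t *\<^sub>R u \<in> range (\<lambda>t. t *\<^sub>R v)" for t
      unfolding c by (rule range_eqI[of _ _ "t * c"]) simp
    show "t *\<^sub>R v \<in> range (\<lambda>t. t *\<^sub>R u)" for t
      unfolding c by (rule range_eqI[of _ _ "t / c"]) (simp add: \<open>c \<noteq> 0\<close>)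
  qed
qed

lemma converges_exponentially_imp_strongly:
  assumes "converges_exponentially \<sigma> u" shows "converges_strongly \<sigma> u"
proof -
  obtain C \<alpha> where \<alpha>: "0 < \<alpha>" and bound: "\<And>(n::nat) i.
      infdist (incidence_matrix (block \<sigma> 0 (int n)) *v axis i 1) (range (\<lambda>t. t *\<^sub>R u))
        \<le> C * exp (- \<alpha> * real n)"
    using assms by (auto simp: converges_exponentially_def)
  have "(\<lambda>n. exp (- \<alpha>) ^ n) \<longlonglongrightarrow> 0" using \<alpha> by (intro LIMSEQ_power_zero) simp
  then have lim: "(\<lambda>n. C * exp (- \<alpha> * real n)) \<longlonglongrightarrow> 0"
    by (intro tendsto_mult_right_zero) (simp add: mult.commute flip: exp_of_nat_mult)
  show ?thesis
    unfolding converges_strongly_def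
  proof (intro allI)
    fix i
    show "(\<lambda>n::nat. infdist (incidence_matrix (block \<sigma> 0 (int n)) *v axis i 1)
        (range (\<lambda>t. t *\<^sub>R u))) \<longlonglongrightarrow> 0"
      by (rule real_tendsto_sandwich[OF _ _ tendsto_const lim])
         (intro always_eventually allI infdist_nonneg bound)+
  qed
qed

section \<open>Rational independence\<close>

lemma common_denominator:
  fixes q :: "'a::finite \<Rightarrow> rat"
  obtains k :: int and z :: "'a \<Rightarrow> int" where "k \<noteq> 0" "\<And>a. of_int k * q a = of_int (z a)"
proof -
  define den where "den a = snd (quotient_of (q a))" for a
  have den: "den a \<noteq> 0" "q a * of_int (den a) = of_int (fst (quotient_of (q a)))" for a
  proof -
    show "den a \<noteq> 0" using quotient_of_denom_pos'[of "q a"] by (simp add: den_def)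
    moreover have "q a = of_int (fst (quotient_of (q a))) / of_int (den a)"
      unfolding den_def by (rule quotient_of_div) simp
    ultimately show "q a * of_int (den a) = of_int (fst (quotient_of (q a)))"
      by (metis nonzero_divide_eq_eq of_int_eq_0_iff)
  qed
  have "\<exists>z. of_int (prod den UNIV) * q a = of_int z" for a
  proof -
    have "prod den UNIV = den a * prod den (UNIV - {a})" by (simp add: prod.remove)
    then have "of_int (prod den UNIV) * q a = (q a * of_int (den a)) * of_int (prod den (UNIV - {a}))"
      by (simp add: mult_ac)
    then show ?thesis unfolding den(2) by (metis of_int_mult)
  qed
  then obtain z where "\<And>a. of_int (prod den UNIV) * q a = of_int (z a)" by metis
  then show thesis using that[of "prod den UNIV"] den(1) by simp
qed

text \<open>Cleared of denominators, a relation is an integer vector \<open>Z\<close> orthogonal to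
  \<open>u\<close>. Its products with the columns are integers tending to 0, hence eventually 0, and
  only \<open>Z = 0\<close> annihilates an invertible matrix.\<close>

lemma rationally_independent_if_converges_strongly:
  fixes \<sigma> :: "int \<Rightarrow> 'a::finite list \<Rightarrow> 'a list"
  assumes uni: "\<And>n. \<sigma> n \<in> unimodular_substitutions" and conv: "converges_strongly \<sigma> u"
  shows "rationally_independent u"
  unfolding rationally_independent_def
proof (intro allI impI)
  fix q :: "'a \<Rightarrow> rat" and a
  assume rel: "(\<Sum>a\<in>UNIV. of_rat (q a) * u $ a) = 0"
  obtain k z where k: "k \<noteq> 0" and kz: "\<And>a. of_int k * q a = of_int (z a)"
    using common_denominator[of q] by blast
  define Z :: "real ^ 'a" where "Z = (\<chi> a. of_int (z a))"
  have Zq: "Z $ a = of_int k * of_rat (q a)" for a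
  proof -
    have "(of_rat (of_int k * q a) :: real) = of_rat (of_int (z a))" by (simp only: kz)
    then show ?thesis by (simp add: Z_def of_rat_mult)
  qed
  have "Z \<bullet> u = of_int k * (\<Sum>a\<in>UNIV. of_rat (q a) * u $ a)"
    by (simp add: inner_vec_def Zq sum_distrib_left mult.assoc)
  then have Zu: "Z \<bullet> u = 0" using rel by simp
  let ?c = "\<lambda>(n::nat) i. counts (block \<sigma> 0 (int n) [i])"
  \<comment> \<open>The factor \<open>norm Z + 1\<close> instead of \<open>norm Z\<close> permits
    division even if \<open>Z = 0\<close>.\<close>
  have small: "\<bar>Z \<bullet> ?c n i\<bar> \<le> (norm Z + 1) * infdist (?c n i) (range (\<lambda>t. t *\<^sub>R u))" for n i
  proof -
    have "\<bar>Z \<bullet> ?c n i\<bar> / (norm Z + 1) \<le> dist (?c n i) (t *\<^sub>R u)" for t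
    proof -
      have "\<bar>Z \<bullet> ?c n i\<bar> = \<bar>Z \<bullet> (?c n i - t *\<^sub>R u)\<bar>" by (simp add: inner_diff_right Zu)
      also have "\<dots> \<le> norm Z * norm (?c n i - t *\<^sub>R u)" by (rule Cauchy_Schwarz_ineq2)
      also have "\<dots> \<le> (norm Z + 1) * norm (?c n i - t *\<^sub>R u)" by (intro mult_right_mono) auto
      finally show ?thesis
        by (simp add: dist_norm pos_divide_le_eq add_nonneg_pos mult.commute)
    qed
    then have "\<bar>Z \<bullet> ?c n i\<bar> / (norm Z + 1) \<le> infdist (?c n i) (range (\<lambda>t. t *\<^sub>R u))"
      using infdist_notempty[of "range (\<lambda>t. t *\<^sub>R u)"]
      by (auto intro!: cINF_greatest)
    then show ?thesis by (simp add: pos_divide_le_eq add_nonneg_pos mult.commute)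
  qed
  have "\<forall>\<^sub>F n in sequentially. Z \<bullet> ?c n i = 0" for i
  proof -
    have "(\<lambda>n. infdist (?c n i) (range (\<lambda>t. t *\<^sub>R u))) \<longlonglongrightarrow> 0"
      using conv by (simp add: converges_strongly_def incidence_matrix_axis)
    then have "(\<lambda>n. (norm Z + 1) * infdist (?c n i) (range (\<lambda>t. t *\<^sub>R u))) \<longlonglongrightarrow> 0"
      by (rule tendsto_mult_right_zero)
    then have "\<forall>\<^sub>F n in sequentially. (norm Z + 1) * infdist (?c n i) (range (\<lambda>t. t *\<^sub>R u)) < 1"
      by (rule order_tendstoD) simp
    then show ?thesis
    proof eventually_elim
      case (elim n)
      let ?m = "\<Sum>a\<in>UNIV. z a * int (count_list (block \<sigma> 0 (int n) [i]) a)"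
      have m: "Z \<bullet> ?c n i = of_int ?m" by (simp add: inner_vec_def Z_def counts_def)
      have "\<bar>Z \<bullet> ?c n i\<bar> < 1" using small[of n i] elim by linarith
      then have "\<bar>?m\<bar> < 1" unfolding m by linarith
      then show ?case unfolding m by linarith
    qed
  qed
  \<comment> \<open>There are finitely many letters, so a single \<open>n\<close> serves all
    columns.\<close>
  then have "\<forall>\<^sub>F n in sequentially. \<forall>i. Z \<bullet> ?c n i = 0" by (rule eventually_all_finite)
  then obtain n where n: "\<And>i. Z \<bullet> ?c n i = 0" by (auto simp: eventually_sequentially)
  let ?A = "incidence_matrix (block \<sigma> 0 (int n))"
  have "(Z v* ?A) $ i = 0" for i
    using n[of i] dot_lmul_matrix[of Z ?A "axis i 1"]
    by (simp add: incidence_matrix_axis inner_axis)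
  then have ZA: "Z v* ?A = 0" by (simp add: vec_eq_iff)
  obtain B where B: "?A ** B = mat 1"
    using det_block_nonzero[of \<sigma>, OF uni, of n] unfolding invertible_det_nz[symmetric] invertible_def
    by blast
  have "Z \<bullet> Z = Z \<bullet> (?A *v (B *v Z))" by (simp add: matrix_vector_mul_assoc B)
  also have "\<dots> = 0" unfolding dot_lmul_matrix[symmetric] ZA by simp
  finally have "Z = 0" by simp
  then show "q a = 0" using Zq[of a] k by simp
qed

section \<open>Prefix decomposition and balance\<close>

text \<open>One level of the Dumont--Thomas decomposition: images of letters are stripped off until
  the rest of \<open>p\<close> lies inside a single image. The alternative \<open>p' = []\<close>
  arises when \<open>w\<close> is exhausted.\<close>

lemma prefix_substitutionE:
  assumes "substitution h" "prefix p (h w)"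
  obtains v p' where "p = h v @ p'" "prefix v w" "p' = [] \<or> (\<exists>b. prefix p' (h [b]))"
proof -
  have "\<exists>v p'. p = h v @ p' \<and> prefix v w \<and> (p' = [] \<or> (\<exists>b. prefix p' (h [b])))"
    using assms(2)
  proof (induction w arbitrary: p)
    case Nil
    then show ?case using substitution_simps(1)[OF assms(1)] by auto
  next
    case (Cons b w)
    then have "prefix p (h [b] @ h w)" using substitution_simps(3)[OF assms(1)] by metis
    then consider "prefix p (h [b])" | p1 where "p = h [b] @ p1" "prefix p1 (h w)"
      by (auto simp: prefix_append)
    then show ?case
    proof cases
      case 1
      then have "p = h [] @ p \<and> prefix [] (b # w)" using substitution_simps(1)[OF assms(1)] by simp
      with 1 show ?thesis by blast
    next
      case 2
      then obtain v p' where v: "p1 = h v @ p'" "prefix v w" "p' = [] \<or> (\<exists>b. prefix p' (h [b]))"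
        using Cons.IH by blast
      then have "p = h (b # v) @ p' \<and> prefix (b # v) (b # w)"
        using 2 substitution_simps(3)[OF assms(1), of b v] by simp
      with v(3) show ?thesis by blast
    qed
  qed
  then show thesis using that by blast
qed

lemma discrepancy_substitution_le:
  assumes "substitution h" "\<And>b. norm (discrepancy u (h [b])) \<le> e"
  shows "norm (discrepancy u (h w)) \<le> real (length w) * e"
proof (induction w)
  case (Cons b w)
  have "norm (discrepancy u (h (b # w))) \<le> norm (discrepancy u (h [b])) + norm (discrepancy u (h w))"
    unfolding substitution_simps(3)[OF assms(1), of b w] discrepancy_simps by (rule norm_triangle_ineq)
  then show ?case using Cons assms(2)[of b] by (simp add: algebra_simps)
qed (simp add: substitution_simps[OF assms(1)] discrepancy_simps)

text \<open>Each level contributes \<open>l n * e n\<close>: the stripped part is the image of at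
  most \<open>l n\<close> letters, each of discrepancy at most \<open>e n\<close>, and the rest is a
  prefix one level lower. At level 0 a prefix has at most one letter, whence
  \<open>e 0\<close>.\<close>

lemma discrepancy_prefix_le:
  fixes \<sigma> :: "int \<Rightarrow> 'a::finite list \<Rightarrow> 'a list"
  assumes sub: "\<And>n. substitution (\<sigma> n)"
    and close: "\<And>(n::nat) i. norm (discrepancy u (block \<sigma> 0 (int n) [i])) \<le> e n"
    and len: "\<And>n b. real (length (\<sigma> (int n) [b])) \<le> l n"
    and "prefix p (block \<sigma> 0 (int n) [a])"
  shows "norm (discrepancy u p) \<le> e 0 + (\<Sum>j<n. l j * e j)"
  using assms(4)
proof (induction n arbitrary: p a)
  case 0
  have "0 \<le> e 0" using order_trans[OF norm_ge_zero close] .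
  moreover have "p = [] \<or> p = [a]"
    using 0 by (auto simp: block_refl prefix_Cons)
  ultimately show ?case using close[of 0 a] by (auto simp: block_refl discrepancy_simps)
next
  case (Suc n)
  let ?h = "block \<sigma> 0 (int n)"
  have e: "0 \<le> e j" for j using order_trans[OF norm_ge_zero close] .
  have l: "0 \<le> l j" for j using order_trans[OF of_nat_0_le_iff len] .
  have "prefix p (?h (\<sigma> (int n) [a]))"
    using Suc.prems block_Suc[of 0 "int n" \<sigma>] by (simp add: add.commute)
  then obtain v p' where v: "p = ?h v @ p'" "prefix v (\<sigma> (int n) [a])"
    and p': "p' = [] \<or> (\<exists>b. prefix p' (?h [b]))"
    using prefix_substitutionE[OF substitution_block[of \<sigma>, OF sub]] by blast
  have "real (length v) \<le> l n"
    using prefix_length_le[OF v(2)] len[of n a] by linarith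
  then have "norm (discrepancy u (?h v)) \<le> l n * e n"
    using order_trans[OF discrepancy_substitution_le[OF substitution_block[of \<sigma>, OF sub] close]
        mult_right_mono[OF _ e[of n]]] by blast
  moreover have "0 \<le> e 0 + (\<Sum>j<n. l j * e j)"
    by (intro add_nonneg_nonneg sum_nonneg mult_nonneg_nonneg e l)
  then have "norm (discrepancy u p') \<le> e 0 + (\<Sum>j<n. l j * e j)"
    using p' Suc.IH by (auto simp: discrepancy_simps)
  ultimately show ?case
    using norm_triangle_ineq[of "discrepancy u (?h v)" "discrepancy u p'"]
    by (simp add: v(1) discrepancy_simps)
qed

text \<open>For words of equal length the multiples of \<open>u\<close> cancel, so counts differ by
  at most \<open>2 * K\<close>.\<close>

lemma balanced_if_bounded_discrepancy:
  assumes "\<And>w. w \<in> L \<Longrightarrow> norm (discrepancy u w) \<le> K"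
  shows "balanced L"
  unfolding balanced_def
proof (intro exI ballI impI allI)
  fix v w a assume vw: "v \<in> L" "w \<in> L" "length v = length w"
  have "real (count_list v a) - real (count_list w a) = (discrepancy u v - discrepancy u w) $ a"
    using vw(3) by (simp add: discrepancy_def counts_nth)
  also have "\<dots> \<le> norm (discrepancy u v - discrepancy u w)"
    using component_le_norm_cart abs_le_D1 by blast
  also have "\<dots> \<le> 2 * K"
    using assms[OF vw(1)] assms[OF vw(2)] norm_triangle_ineq4[of "discrepancy u v" "discrepancy u w"]
    by linarith
  finally show "int (count_list v a) - int (count_list w a) \<le> int (nat \<lceil>2 * K\<rceil>)" by linarith
qed

text \<open>A factor \<open>w\<close> is what separates the prefixes \<open>p\<close> and
  \<open>p @ w\<close>, which doubles the prefix bound; summability makes it uniform in the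
  level.\<close>

lemma balanced_language:
  fixes \<sigma> :: "int \<Rightarrow> 'a::finite list \<Rightarrow> 'a list"
  assumes sub: "\<And>n. substitution (\<sigma> n)"
    and close: "\<And>(n::nat) i. norm (discrepancy u (block \<sigma> 0 (int n) [i])) \<le> e n"
    and len: "\<And>n b. real (length (\<sigma> (int n) [b])) \<le> l n"
    and summable: "summable (\<lambda>n. l n * e n)"
  shows "balanced (language \<sigma>)"
proof (rule balanced_if_bounded_discrepancy)
  fix w assume "w \<in> language \<sigma>"
  then obtain a m where m: "m > 0" "sublist w (block \<sigma> 0 m [a])" by (auto simp: language_def)
  then obtain p s where "block \<sigma> 0 (int (nat m)) [a] = p @ w @ s" by (auto simp: sublist_def)
  then have p: "prefix p (block \<sigma> 0 (int (nat m)) [a])" "prefix (p @ w) (block \<sigma> 0 (int (nat m)) [a])"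
    by simp_all
  have "0 \<le> l n * e n" for n
    using order_trans[OF of_nat_0_le_iff len[of n]] order_trans[OF norm_ge_zero close[of n]] by simp
  then have sum: "(\<Sum>j<nat m. l j * e j) \<le> (\<Sum>j. l j * e j)"
    using summable by (intro sum_le_suminf) auto
  have "norm (discrepancy u w) \<le> norm (discrepancy u (p @ w)) + norm (discrepancy u p)"
    using norm_triangle_ineq4[of "discrepancy u (p @ w)" "discrepancy u p"]
    by (simp add: discrepancy_simps)
  then show "norm (discrepancy u w) \<le> 2 * (e 0 + (\<Sum>j. l j * e j))"
    unfolding distrib_left using sum discrepancy_prefix_le[of \<sigma>, OF sub close len p(1)] discrepancy_prefix_le[of \<sigma>, OF sub close len p(2)]
    by linarith
qed

theorem theorem11p8:
  fixes \<sigma> :: "int \<Rightarrow> 'a::finite list \<Rightarrow> 'a list"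
    and N :: "real ^ 'a ^ 'a \<Rightarrow> real"
  assumes "CARD('a) \<ge> 2"
    and "\<And>n. \<sigma> n \<in> unimodular_substitutions"
    and "primitive \<sigma>"
    and "local_Pisot \<sigma>"
    and "is_norm N"
    and "growth_condition N \<sigma>"
  shows "(\<exists>u. generalized_right_eigenvector \<sigma> u) \<and>
    (\<forall>u. generalized_right_eigenvector \<sigma> u \<longrightarrow>
       converges_exponentially \<sigma> u \<and> converges_strongly \<sigma> u \<and> rationally_independent u) \<and>
    balanced (language \<sigma>)"
proof -
  have sub: "substitution (\<sigma> n)" for n
    using assms(2) by (simp add: unimodular_substitutions_def)
  obtain u C G r s where u: "u \<in> nonneg_orthant" "coord_sum u = 1"
    "(\<lambda>n::nat. (1 / coord_sum (incidence_matrix (block \<sigma> 0 (int n)) *v 1))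
        *\<^sub>R (incidence_matrix (block \<sigma> 0 (int n)) *v 1)) \<longlonglongrightarrow> u"
    and C: "0 < C" and close: "\<And>n i. norm (discrepancy u (block \<sigma> 0 (int n) [i])) \<le> C * r ^ n"
    and G: "0 \<le> G" and len: "\<And>n b. real (length (\<sigma> (int n) [b])) \<le> G * s ^ n"
    and rs: "0 < r" "1 < s" "r * s < 1"
    by (rule limit_direction[OF assms(1,2,4,5,6)]) blast
  have "r * 1 \<le> r * s" using rs by (intro mult_left_mono) auto
  then have r1: "r < 1" using rs by linarith
  have "(\<lambda>n. C * r ^ n) \<longlonglongrightarrow> 0"
    using rs r1 by (intro tendsto_mult_right_zero LIMSEQ_power_zero) auto
  then have eig: "generalized_right_eigenvector \<sigma> u"
    by (rule generalized_right_eigenvector_limit[of \<sigma>, OF assms(2) u close])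
  have "converges_exponentially \<sigma> w \<and> converges_strongly \<sigma> w \<and> rationally_independent w"
    if w: "generalized_right_eigenvector \<sigma> w" for w
  proof -
    have "infdist (incidence_matrix (block \<sigma> 0 (int n)) *v axis i 1) (range (\<lambda>t. t *\<^sub>R w))
        \<le> C * exp (- (- ln r) * real n)" for n :: nat and i
    proof -
      \<comment> \<open>The comparison point on the line is the length of the word times
        \<open>u\<close>; the decay rate is \<open>- ln r\<close>.\<close>
      have "infdist (counts (block \<sigma> 0 (int n) [i])) (range (\<lambda>t. t *\<^sub>R u)) \<le> C * r ^ n"
        by (rule infdist_le2[of "real (length (block \<sigma> 0 (int n) [i])) *\<^sub>R u"])
           (use close in \<open>auto simp: dist_norm discrepancy_def\<close>)
      moreover have "r ^ n = exp (- (- ln r) * real n)"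
        using rs exp_of_nat_mult[of n "ln r"] by (simp add: mult.commute)
      ultimately show ?thesis
        unfolding incidence_matrix_axis generalized_right_eigenvector_unique[OF w eig] by simp
    qed
    moreover have "0 < - ln r" using rs r1 by simp
    ultimately have "converges_exponentially \<sigma> w"
      unfolding converges_exponentially_def using C by blast
    then show ?thesis
      using converges_exponentially_imp_strongly
        rationally_independent_if_converges_strongly[of \<sigma>, OF assms(2)] by blast
  qed
  \<comment> \<open>The reserve \<open>r * s < 1\<close> is used here: length bound times
    discrepancy bound is a convergent geometric series.\<close>
  moreover have "summable (\<lambda>n. (G * s ^ n) * (C * r ^ n))"
  proof -
    have "summable (\<lambda>n. (G * C) * (r * s) ^ n)"
      using rs by (intro summable_mult summable_geometric) simp
    then show ?thesis by (simp add: power_mult_distrib mult_ac)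
  qed
  then have "balanced (language \<sigma>)"
    by (rule balanced_language[of \<sigma>, OF sub close len])
  ultimately show ?thesis using eig by blast
qed

end
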